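(* There is a catalytic algorithm that, given oracle access to a simple directed graph $G$ with $n$ vertices and $m$ edges together with vertices $s,t$, decides whether there exists a directed path from $s$ to $t$ in $G$. The algorithm uses $O(\log n)$ workspace and $\widetilde{O}(n^2)$ catalytic space, and runs in time $\widetilde{O}(n^3 m)$.
   Context: Catalytic (RAM) model: the algorithm has read-only access to the input, read-write access to a small work tape, read-write access to a catalytic tape that starts in an arbitrary configuration $\tau$, and a write-only output tape; it may read or write any specified bit of the catalytic tape in constant time after writing the bit's index to a query tape. For every input and every initial $\tau$, the algorithm must halt within the stated time with the correct output and with the catalytic tape restored exactly to $\tau$. Oracle access to a graph: the vertex set is $[n]=\{0,\dots,n-1\}$ and for any vertex $v$ one can query its in-degree, its out-degree, its $i$-th in-neighbor and its $i$-th out-neighbor (or $\perp$ if it does not exist). $\widetilde{O}(\cdot)$ hides polylogarithmic factors. *)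

theory Defs
  imports Complex_Main "HOL-Library.Log_Nat" "Graph_Theory.Pair_Digraph"
begin

section \<open>Oracle access to a directed graph\<close>

record graph_oracle =
  order_of :: nat
  source_of :: nat
  target_of :: nat
  in_nbrs :: "nat \<Rightarrow> nat list"
  out_nbrs :: "nat \<Rightarrow> nat list"

text \<open>The neighbors of a vertex are enumerated in an arbitrary (adversarial) order.\<close>

definition oracle_for :: "nat pair_pre_digraph \<Rightarrow> nat \<Rightarrow> nat \<Rightarrow> graph_oracle \<Rightarrow> bool" where
  "oracle_for G s t I \<longleftrightarrow>
     pverts G = {..<order_of I} \<and> source_of I = s \<and> target_of I = t \<and>
     (\<forall>v<order_of I.
        distinct (in_nbrs I v) \<and> set (in_nbrs I v) = {u. (u, v) \<in> parcs G} \<and>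
        distinct (out_nbrs I v) \<and> set (out_nbrs I v) = {w. (v, w) \<in> parcs G})"

datatype query =
  Order | Source | Target | In_Degree | Out_Degree | In_Neighbor | Out_Neighbor

text \<open>Vertices and neighbor positions are numbered from 0; \<^const>\<open>None\<close> is the answer
  ``does not exist''.\<close>

fun answer_to :: "graph_oracle \<Rightarrow> query \<Rightarrow> nat \<Rightarrow> nat \<Rightarrow> nat option" where
  "answer_to I Order v i = Some (order_of I)"
| "answer_to I Source v i = Some (source_of I)"
| "answer_to I Target v i = Some (target_of I)"
| "answer_to I In_Degree v i =
     (if v < order_of I then Some (length (in_nbrs I v)) else None)"
| "answer_to I Out_Degree v i =
     (if v < order_of I then Some (length (out_nbrs I v)) else None)"
| "answer_to I In_Neighbor v i =
     (if v < order_of I \<and> i < length (in_nbrs I v) then Some (in_nbrs I v ! i) else None)"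
| "answer_to I Out_Neighbor v i =
     (if v < order_of I \<and> i < length (out_nbrs I v) then Some (out_nbrs I v ! i) else None)"


section \<open>Catalytic machines with random access to the catalytic tape\<close>

text \<open>
  A machine has a finite control, a work tape, a query tape \<open>Cat_Index\<close> holding an index into the
  catalytic tape, two query tapes \<open>Vertex_Arg\<close> and \<open>Position_Arg\<close> holding the arguments of
  a query to the graph, and an \<open>Answer\<close> tape on which the oracle writes and which the machine can
  only read. All of these are one-way infinite, initially blank, and count as workspace.
  The catalytic tape is a finite bit list that is accessed only through \<open>Cat_Index\<close>, and the
  write-only output tape can only be appended to.

  Tape symbols are numbers below a constant; 0 is the blank, 1 and 2 are the binary digits 0 and 1,
  and the meaning of any further symbols is up to the machine.
\<close>

datatype tape = Work | Cat_Index | Vertex_Arg | Position_Arg | Answer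

datatype dir = Move_Left | Stay | Move_Right

datatype action =
  Tapes "tape \<Rightarrow> nat" "tape \<Rightarrow> dir"
| Cat_Read
| Cat_Write bool
| Ask query
| Emit bool

text \<open>The transition function sees the current state, the symbols under the heads, and the one-bit
  reply to the most recent catalytic read or oracle query.\<close>

record machine =
  num_states :: nat
  num_symbols :: nat
  start_state :: nat
  halt_state :: nat
  trans :: "nat \<Rightarrow> (tape \<Rightarrow> nat) \<Rightarrow> bool \<Rightarrow> nat \<times> action"

definition wf_machine :: "machine \<Rightarrow> bool" where
  "wf_machine M \<longleftrightarrow>
     3 \<le> num_symbols M \<and> start_state M < num_states M \<and> halt_state M < num_states M \<and>
     (\<forall>q r b. q < num_states M \<longrightarrow> (\<forall>x. r x < num_symbols M) \<longrightarrow>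
        (case trans M q r b of (q', a) \<Rightarrow>
           q' < num_states M \<and>
           (\<forall>w d. a = Tapes w d \<longrightarrow> (\<forall>x. w x < num_symbols M))))"

record config =
  state :: nat
  reply :: bool
  cells :: "tape \<Rightarrow> nat \<Rightarrow> nat"
  pos :: "tape \<Rightarrow> nat"
  cat :: "bool list"
  out_bits :: "bool list"

definition init_config :: "machine \<Rightarrow> bool list \<Rightarrow> config" where
  "init_config M \<tau> =
     \<lparr>state = start_state M, reply = False, cells = (\<lambda>_ _. 0), pos = (\<lambda>_. 0),
      cat = \<tau>, out_bits = []\<rparr>"

text \<open>Numbers are written in binary, least significant digit in cell 0. When a query tape is read,
  every cell that does not hold the digit 1 counts as 0.\<close>

definition tape_number :: "(nat \<Rightarrow> nat) \<Rightarrow> nat" where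
  "tape_number f = (\<Sum>j | f j = 2. 2 ^ j)"

definition number_tape :: "nat \<Rightarrow> nat \<Rightarrow> nat" where
  "number_tape x j = (if j < floorlog 2 x then (if bit x j then 2 else 1) else 0)"

fun move :: "dir \<Rightarrow> nat \<Rightarrow> nat" where
  "move Move_Left p = p - 1"
| "move Stay p = p"
| "move Move_Right p = Suc p"

text \<open>\<^const>\<open>None\<close> means that the machine crashes: it addresses a bit beyond the end of the
  catalytic tape. The length of the catalytic tape is thus not observable by a run that halts.
  An oracle query sets the reply bit iff the requested object exists; if it does not, the answer
  tape is blank.\<close>

fun perform :: "graph_oracle \<Rightarrow> action \<Rightarrow> config \<Rightarrow> config option" where
  "perform I (Tapes w d) c =
     Some (c\<lparr>cells := (\<lambda>x. if x = Answer then cells c x else (cells c x)(pos c x := w x)),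
             pos := (\<lambda>x. move (d x) (pos c x))\<rparr>)"
| "perform I Cat_Read c =
     (let i = tape_number (cells c Cat_Index) in
      if i < length (cat c) then Some (c\<lparr>reply := cat c ! i\<rparr>) else None)"
| "perform I (Cat_Write b) c =
     (let i = tape_number (cells c Cat_Index) in
      if i < length (cat c) then Some (c\<lparr>cat := (cat c)[i := b]\<rparr>) else None)"
| "perform I (Ask k) c =
     (case answer_to I k (tape_number (cells c Vertex_Arg)) (tape_number (cells c Position_Arg)) of
        None \<Rightarrow> Some (c\<lparr>reply := False, cells := (cells c)(Answer := (\<lambda>_. 0))\<rparr>)
      | Some x \<Rightarrow> Some (c\<lparr>reply := True, cells := (cells c)(Answer := number_tape x)\<rparr>))"
| "perform I (Emit b) c = Some (c\<lparr>out_bits := out_bits c @ [b]\<rparr>)"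

definition step :: "machine \<Rightarrow> graph_oracle \<Rightarrow> config \<Rightarrow> config option" where
  "step M I c =
     (if state c = halt_state M then None
      else case trans M (state c) (\<lambda>x. cells c x (pos c x)) (reply c) of
             (q, a) \<Rightarrow> perform I a (c\<lparr>state := q\<rparr>))"

primrec run :: "machine \<Rightarrow> graph_oracle \<Rightarrow> config \<Rightarrow> nat \<Rightarrow> config option" where
  "run M I c 0 = Some c"
| "run M I c (Suc j) = Option.bind (run M I c j) (step M I)"

text \<open>Each tape holds constant-size symbols, and there are constantly many tapes, so keeping all heads
  within the first \<open>W\<close> cells amounts to a workspace of \<open>O(W)\<close> bits.\<close>

definition catalytic_decides ::
    "machine \<Rightarrow> graph_oracle \<Rightarrow> bool list \<Rightarrow> real \<Rightarrow> real \<Rightarrow> bool \<Rightarrow> bool" where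
  "catalytic_decides M I \<tau> W T b \<longleftrightarrow>
     (\<exists>k c. real k \<le> T \<and> run M I (init_config M \<tau>) k = Some c \<and>
        state c = halt_state M \<and> out_bits c = [b] \<and> cat c = \<tau> \<and>
        (\<forall>j\<le>k. \<forall>d x. run M I (init_config M \<tau>) j = Some d \<longrightarrow> real (pos d x) < W))"

end

theory Submission
  imports Defs
begin

text \<open>
  Give every vertex \<open>v\<close> two registers \<open>x v\<close> and \<open>y v\<close>, integers modulo \<open>2 ^ B\<close> with
  \<open>B = O(n log n)\<close>, whose initial contents are whatever the catalytic tape holds. One round adds
  \<open>A x\<close> to \<open>y\<close> and then \<open>A y\<close> to \<open>x\<close>, where \<open>A\<close> is the adjacency matrix. Since a half round
  reads only one family of registers and changes only the other one, it is undone by the same loop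
  with subtraction. Changing \<open>x s\<close> by one unit changes \<open>x t\<close> and \<open>y t\<close> after \<open>n\<close> rounds by
  numbers below \<open>2 ^ B\<close> that count walks from \<open>s\<close> to \<open>t\<close>, and these vanish simultaneously iff
  \<open>t\<close> is unreachable. The change is detected bit by bit: run the rounds, remember one bit of the
  target registers, undo the rounds, flip the lowest bit of \<open>x s\<close>, and repeat. The second flip
  restores the tape.
\<close>

section \<open>Compiling register instructions to sweeps over the tapes\<close>

text \<open>Neither the unknown contents nor wrap-around can hide an answer. A round is linear, so
  two runs that differ by a unit at \<open>x s\<close> end with a difference that does not depend on
  the contents; its entries all have the same sign, so different walks never cancel. Each of the
  \<open>2 * n\<close> half rounds multiplies the largest entry by at most \<open>n + 1\<close>,
  hence the \<open>n log n\<close> bits of precision. Both target registers are inspected because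
  every arc leads from one family to the other: \<open>x t\<close> sees only walks of even length
  and \<open>y t\<close> only those of odd length.

  The other half of the work is the machine model: arithmetic on numbers of \<open>O(log n)\<close>
  bits is done by heads sweeping over tapes, which costs one more logarithmic factor.\<close>

definition track :: "nat \<Rightarrow> nat \<Rightarrow> bool" where
  "track s i = bit s i"

definition put :: "nat \<Rightarrow> bool \<Rightarrow> nat \<Rightarrow> nat" where
  "put i b s = (if b then set_bit i s else unset_bit i s)"

lemma track_put [simp]: "track (put i b s) j = (if j = i then b else track s j)"
  by (auto simp: track_def put_def bit_set_bit_iff bit_unset_bit_iff possible_bit_def)

lemma nat_less_power_iff_bit: "(s::nat) < 2 ^ k \<longleftrightarrow> (\<forall>j\<ge>k. \<not> bit s j)"
proof
  assume "s < 2 ^ k"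
  then have "take_bit k s = s" by (simp add: take_bit_nat_eq_self)
  then show "\<forall>j\<ge>k. \<not> bit s j"
    by (metis bit_take_bit_iff linorder_not_le)
next
  assume "\<forall>j\<ge>k. \<not> bit s j"
  then have "take_bit k s = s"
    by (intro bit_eqI) (auto simp: bit_take_bit_iff not_le)
  then show "s < 2 ^ k" by (metis take_bit_nat_less_exp)
qed

lemma put_less: "s < 2 ^ k \<Longrightarrow> i < k \<Longrightarrow> put i b s < 2 ^ k"
  using track_put[of i b s] unfolding nat_less_power_iff_bit track_def by auto

datatype operand = Nil_Op | Reg_Op nat | Answer_Op

text \<open>Every sweep is an automaton with one bit of memory that runs from the lowest digit
  upwards. \<open>Add\<close> covers all assignments: \<open>keep\<close> selects whether the old
  value takes part, and the initial memory is an incoming carry. For \<open>Compare\<close> the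
  memory is the verdict on the digits seen so far, which a differing higher digit overrules.\<close>

datatype sweep = Add nat bool operand | Compare nat nat

fun operand_bit :: "operand \<Rightarrow> nat \<Rightarrow> nat \<Rightarrow> bool" where
  "operand_bit Nil_Op s z = False"
| "operand_bit (Reg_Op b) s z = track s (Suc (Suc b))"
| "operand_bit Answer_Op s z = (z = 2)"

fun column :: "sweep \<Rightarrow> bool \<Rightarrow> nat \<Rightarrow> nat \<Rightarrow> bool \<times> nat" where
  "column (Add a keep src) c s z =
     (let x = keep \<and> track s (Suc (Suc a)); y = operand_bit src s z
      in ((x \<and> y) \<or> (c \<and> (x \<or> y)), put (Suc (Suc a)) (x \<noteq> (y \<noteq> c)) s))"
| "column (Compare a b) c s z =
     (let x = track s (Suc (Suc a)); y = track s (Suc (Suc b))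
      in (if x = y then c else y, s))"

text \<open>Cells are taken into use on demand, so a sweep goes on past them while a carry survives
  or the answer tape has digits left. Digits are written as 1 and 2, so the blank 0 marks the end of
  an answer.\<close>

fun unfinished :: "sweep \<Rightarrow> bool \<Rightarrow> nat \<Rightarrow> bool" where
  "unfinished (Add a keep src) c z = (c \<or> (src = Answer_Op \<and> z \<noteq> 0))"
| "unfinished (Compare a b) c z = False"

datatype instr =
  Arith nat bool "nat option" bool
| Read nat
| Write nat
| Query query nat
| Out bool
| Jump_Unless_Less nat nat nat

fun sweep_of :: "instr \<Rightarrow> sweep" where
  "sweep_of (Arith a keep b cin) = Add a keep (case b of None \<Rightarrow> Nil_Op | Some b \<Rightarrow> Reg_Op b)"
| "sweep_of (Query k a) = Add a False Answer_Op"
| "sweep_of (Read a) = Add a False Nil_Op"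
| "sweep_of (Jump_Unless_Less a b l) = Compare a b"
| "sweep_of (Write a) = Compare a a"
| "sweep_of (Out v) = Compare 0 0"

fun next_pc :: "instr \<Rightarrow> nat \<Rightarrow> bool \<Rightarrow> nat" where
  "next_pc (Jump_Unless_Less a b l) pc c = (if c then Suc pc else l)"
| "next_pc _ pc c = Suc pc"

text \<open>
  All heads move in lockstep, so a single position is relevant at any time. The registers are tracks
  of the work tape, least significant bit first; track 0 marks the cells in use, track 1 marks
  cell 0, and track \<open>r + 2\<close> belongs to register \<open>r\<close>. Registers 0, 1 and 2 are mirrored on the
  query tapes.
\<close>

fun column_symbols :: "nat \<Rightarrow> tape \<Rightarrow> nat" where
  "column_symbols s Work = s"
| "column_symbols s Cat_Index = (if track s (Suc (Suc 0)) then 2 else 1)"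
| "column_symbols s Vertex_Arg = (if track s (Suc (Suc 1)) then 2 else 1)"
| "column_symbols s Position_Arg = (if track s (Suc (Suc 2)) then 2 else 1)"
| "column_symbols s Answer = 0"

definition column_step ::
    "instr \<Rightarrow> nat \<Rightarrow> bool \<Rightarrow> bool \<Rightarrow> (tape \<Rightarrow> nat) \<Rightarrow> nat \<times> action" where
  "column_step i pc first c r =
     (let (c', s) = column (sweep_of i) c (r Work) (r Answer)
      in (6 * pc + (if c' then 2 else 1),
          Tapes (column_symbols (put 0 True (put (Suc 0) first s))) (\<lambda>_. Move_Right)))"

fun entry_step :: "instr \<Rightarrow> nat \<Rightarrow> (tape \<Rightarrow> nat) \<Rightarrow> nat \<times> action" where
  "entry_step (Arith a keep b cin) pc r = column_step (Arith a keep b cin) pc True cin r"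
| "entry_step (Jump_Unless_Less a b l) pc r =
     column_step (Jump_Unless_Less a b l) pc True False r"
| "entry_step (Read a) pc r = (6 * pc + 5, Cat_Read)"
| "entry_step (Query k a) pc r = (6 * pc + 5, Ask k)"
| "entry_step (Write a) pc r = (6 * Suc pc, Cat_Write (track (r Work) (Suc (Suc a))))"
| "entry_step (Out v) pc r = (6 * Suc pc, Emit v)"

text \<open>The bit obtained by a catalytic read enters its register as the incoming carry of the
  sum 0 + 0.\<close>

fun second_carry :: "instr \<Rightarrow> bool \<Rightarrow> bool" where
  "second_carry (Read a) b = b"
| "second_carry _ b = False"

definition right_step :: "instr \<Rightarrow> nat \<Rightarrow> bool \<Rightarrow> (tape \<Rightarrow> nat) \<Rightarrow> nat \<times> action" where
  "right_step i pc c r =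
     (if track (r Work) 0 \<or> unfinished (sweep_of i) c (r Answer) then column_step i pc False c r
      else (6 * pc + (if c then 4 else 3), Tapes r (\<lambda>_. Move_Left)))"

text \<open>Moving left at cell 0 leaves the head there without notice, so the return relies on the
  mark in track 1 to recognise cell 0.\<close>

definition left_step :: "instr \<Rightarrow> nat \<Rightarrow> bool \<Rightarrow> (tape \<Rightarrow> nat) \<Rightarrow> nat \<times> action" where
  "left_step i pc c r =
     (if track (r Work) (Suc 0) then (6 * next_pc i pc c, Tapes r (\<lambda>_. Stay))
      else (6 * pc + (if c then 4 else 3), Tapes r (\<lambda>_. Move_Left)))"

text \<open>
  State \<open>6 * pc + u\<close> is phase \<open>u\<close> of instruction \<open>pc\<close>: entry (0), sweeping right with carry 0 or
  1 (1, 2), returning with final carry 0 or 1 (3, 4), and starting the sweep that consumes the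
  reply to a query (5).
\<close>

definition instr_step :: "instr \<Rightarrow> nat \<Rightarrow> nat \<Rightarrow> (tape \<Rightarrow> nat) \<Rightarrow> bool \<Rightarrow> nat \<times> action" where
  "instr_step i pc u r b =
     (if u = 0 then entry_step i pc r
      else if u = 1 then right_step i pc False r
      else if u = 2 then right_step i pc True r
      else if u = 3 then left_step i pc False r
      else if u = 4 then left_step i pc True r
      else column_step i pc True (second_carry i b) r)"

text \<open>A program halts by running past its end: the halting state is the entry phase of the
  position after the last instruction, which is also a legal jump target.\<close>

definition instr_machine :: "nat \<Rightarrow> instr list \<Rightarrow> machine" where
  "instr_machine K P =
     \<lparr>num_states = 6 * length P + 6, num_symbols = 2 ^ K, start_state = 0,
      halt_state = 6 * length P,
      trans = (\<lambda>q r b. if q div 6 < length P then instr_step (P ! (q div 6)) (q div 6) (q mod 6) r b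
                       else (q, Tapes r (\<lambda>_. Stay)))\<rparr>"

text \<open>Writing a track at or above \<open>K\<close> would leave the alphabet, so destinations
  are bounded; reading such a track just gives 0.\<close>

fun instr_wf :: "nat \<Rightarrow> nat \<Rightarrow> instr \<Rightarrow> bool" where
  "instr_wf K l (Arith a keep b cin) \<longleftrightarrow> Suc (Suc a) < K"
| "instr_wf K l (Read a) \<longleftrightarrow> Suc (Suc a) < K"
| "instr_wf K l (Query k a) \<longleftrightarrow> Suc (Suc a) < K"
| "instr_wf K l (Jump_Unless_Less a b j) \<longleftrightarrow> j \<le> l"
| "instr_wf K l _ \<longleftrightarrow> True"

lemma column_less:
  assumes "instr_wf K l i" "s < 2 ^ K"
  shows "snd (column (sweep_of i) c s z) < 2 ^ K"
  using assms by (cases i) (auto simp: Let_def intro!: put_less)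

lemma column_symbols_less:
  assumes "s < 2 ^ K" "2 \<le> K"
  shows "column_symbols s x < 2 ^ K"
proof -
  have "(2::nat) ^ 2 \<le> 2 ^ K" using assms(2) by (intro power_increasing) auto
  then show ?thesis using assms by (cases x) auto
qed

definition transition_wf :: "nat \<Rightarrow> nat \<Rightarrow> nat \<times> action \<Rightarrow> bool" where
  "transition_wf n k qa \<longleftrightarrow>
     fst qa < n \<and> (\<forall>w d. snd qa = Tapes w d \<longrightarrow> (\<forall>x. w x < k))"

lemma column_step_wf:
  assumes "instr_wf K l i" "pc < l" "\<forall>x. r x < 2 ^ K" "2 \<le> K"
  shows "transition_wf (6 * l + 6) (2 ^ K) (column_step i pc first c r)"
proof -
  obtain c' s where cs: "column (sweep_of i) c (r Work) (r Answer) = (c', s)" by fastforce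
  then have "s < 2 ^ K" using column_less[OF assms(1), of "r Work" c "r Answer"] assms(3) by auto
  then have "put 0 True (put (Suc 0) first s) < 2 ^ K"
    using assms(4) by (intro put_less) auto
  then show ?thesis using assms(2,4) cs column_symbols_less
    by (auto simp: column_step_def transition_wf_def)
qed

lemma instr_step_wf:
  assumes "instr_wf K l i" "pc < l" "\<forall>x. r x < 2 ^ K" "2 \<le> K"
  shows "transition_wf (6 * l + 6) (2 ^ K) (instr_step i pc u r b)"
proof -
  note cw = column_step_wf[OF assms]
  have n: "next_pc i pc c \<le> l" for c using assms(1,2) by (cases i) auto
  have "transition_wf (6 * l + 6) (2 ^ K) (entry_step i pc r)"
    using cw assms(2) by (cases i) (auto simp: transition_wf_def)
  moreover have "transition_wf (6 * l + 6) (2 ^ K) (right_step i pc c r)" for c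
    using cw assms(2,3) by (auto simp: right_step_def) (auto simp: transition_wf_def)
  moreover have "transition_wf (6 * l + 6) (2 ^ K) (left_step i pc c r)" for c
    using n[of c] assms(2,3) by (auto simp: left_step_def transition_wf_def)
  ultimately show ?thesis using cw by (auto simp: instr_step_def)
qed

lemma wf_instr_machine:
  assumes "\<forall>i\<in>set P. instr_wf K (length P) i" "2 \<le> K"
  shows "wf_machine (instr_machine K P)"
proof -
  have three: "(3::nat) \<le> 2 ^ K"
    using assms(2) power_increasing[of 2 K "2::nat"] by simp
  have step: "transition_wf (6 * length P + 6) (2 ^ K) (trans (instr_machine K P) q r b)"
    if "q < 6 * length P + 6" "\<forall>x. r x < 2 ^ K" for q r b
  proof (cases "q div 6 < length P")
    case True
    then show ?thesis using assms that by (simp add: instr_machine_def instr_step_wf)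
  next
    case False
    then show ?thesis using that by (simp add: instr_machine_def transition_wf_def)
  qed
  have "case trans (instr_machine K P) q r b of (q', a) \<Rightarrow>
      q' < 6 * length P + 6 \<and> (\<forall>w d. a = Tapes w d \<longrightarrow> (\<forall>x. w x < 2 ^ K))"
    if "q < 6 * length P + 6" "\<forall>x. r x < 2 ^ K" for q r b
    using step[OF that, of b] unfolding transition_wf_def by (simp add: case_prod_unfold)
  then show ?thesis
    using three unfolding wf_machine_def by (simp add: instr_machine_def)
qed

section \<open>Correctness of a sweep\<close>

definition leads :: "machine \<Rightarrow> graph_oracle \<Rightarrow> nat \<Rightarrow> nat \<Rightarrow> config \<Rightarrow> (config \<Rightarrow> bool) \<Rightarrow> bool" where
  "leads M I W t c Q \<longleftrightarrow>
     (\<exists>k\<le>t. \<exists>d. run M I c k = Some d \<and> Q d \<and>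
        (\<forall>j\<le>k. \<forall>e x. run M I c j = Some e \<longrightarrow> pos e x \<le> W))"

lemma run_Suc_left: "run M I c (Suc k) = Option.bind (step M I c) (\<lambda>d. run M I d k)"
proof (induction k)
  case (Suc k)
  have "run M I c (Suc (Suc k)) = Option.bind (run M I c (Suc k)) (step M I)" by simp
  also have "\<dots> = Option.bind (step M I c) (\<lambda>d. run M I d (Suc k))"
    unfolding Suc.IH by (cases "step M I c") auto
  finally show ?case .
qed simp

lemma leads_refl: "Q c \<Longrightarrow> \<forall>x. pos c x \<le> W \<Longrightarrow> leads M I W t c Q"
  unfolding leads_def by (rule exI[of _ 0]) auto

lemma leads_step:
  assumes "step M I c = Some d" "\<forall>x. pos c x \<le> W" "leads M I W t d Q"
  shows "leads M I W (Suc t) c Q"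
proof -
  obtain k e where k: "k \<le> t" "run M I d k = Some e" "Q e"
    "\<forall>j\<le>k. \<forall>e x. run M I d j = Some e \<longrightarrow> pos e x \<le> W"
    using assms(3) unfolding leads_def by blast
  have "pos e' x \<le> W" if "j \<le> Suc k" "run M I c j = Some e'" for j e' x
  proof (cases j)
    case 0
    then show ?thesis using that assms(2) by simp
  next
    case (Suc j')
    then show ?thesis using that k(4) assms(1) by (auto simp: run_Suc_left simp del: run.simps)
  qed
  moreover have "run M I c (Suc k) = Some e"
    using assms(1) k(2) by (simp add: run_Suc_left del: run.simps)
  ultimately show ?thesis using k(1,3) unfolding leads_def by (intro exI[of _ "Suc k"]) auto
qed

lemma leads_mono:
  "leads M I W t c Q \<Longrightarrow> t \<le> t' \<Longrightarrow> (\<And>d. Q d \<Longrightarrow> Q' d) \<Longrightarrow> leads M I W t' c Q'"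
  unfolding leads_def by (meson le_trans)

lemma leads_trans:
  assumes "leads M I W t c Q" "\<And>d. Q d \<Longrightarrow> leads M I W t' d Q'"
  shows "leads M I W (t + t') c Q'"
proof -
  obtain k d where k: "k \<le> t" "run M I c k = Some d" "Q d"
    "\<forall>j\<le>k. \<forall>e x. run M I c j = Some e \<longrightarrow> pos e x \<le> W"
    using assms(1) unfolding leads_def by blast
  have "leads M I W (k + t') c Q'"
    using k(2,4)
  proof (induction k arbitrary: c)
    case 0
    then show ?case using assms(2)[OF k(3)] by simp
  next
    case (Suc k)
    then obtain c' where c': "step M I c = Some c'" "run M I c' k = Some d"
      by (auto simp: run_Suc_left bind_eq_Some_conv simp del: run.simps)
    have "\<forall>j\<le>k. \<forall>e x. run M I c' j = Some e \<longrightarrow> pos e x \<le> W"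
    proof (intro allI impI)
      fix j e x
      assume "j \<le> k" "run M I c' j = Some e"
      then show "pos e x \<le> W"
        using Suc.prems(2)[rule_format, of "Suc j" e x] c'(1)
        by (simp add: run_Suc_left del: run.simps)
    qed
    moreover have "\<forall>x. pos c x \<le> W" using Suc.prems(2)[rule_format, of 0 c] by simp
    ultimately show ?case using leads_step[OF c'(1)] Suc.IH[OF c'(2)] by simp
  qed
  then show ?thesis by (rule leads_mono) (use k(1) in auto)
qed

text \<open>The first \<open>w\<close> cells are in use and \<open>\<beta> r j\<close> is digit
  \<open>j\<close> of register \<open>r\<close>. For \<open>w = 0\<close> no cell is marked, so the
  blank tapes of the start represent registers that are all 0. The mirrored tapes only have to carry
  2 at the right places, since every other symbol counts as 0 in a query.\<close>

definition tapes_hold :: "nat \<Rightarrow> (nat \<Rightarrow> nat \<Rightarrow> bool) \<Rightarrow> (tape \<Rightarrow> nat \<Rightarrow> nat) \<Rightarrow> bool" where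
  "tapes_hold w \<beta> f \<longleftrightarrow>
     (\<forall>j. (track (f Work j) 0 \<longleftrightarrow> j < w) \<and> (track (f Work j) (Suc 0) \<longleftrightarrow> j = 0 \<and> 0 < w) \<and>
        (\<forall>r. track (f Work j) (Suc (Suc r)) \<longleftrightarrow> \<beta> r j) \<and> (\<forall>r. \<beta> r j \<longrightarrow> j < w) \<and>
        (f Cat_Index j = 2 \<longleftrightarrow> \<beta> 0 j) \<and> (f Vertex_Arg j = 2 \<longleftrightarrow> \<beta> 1 j) \<and>
        (f Position_Arg j = 2 \<longleftrightarrow> \<beta> 2 j))"

lemma tapes_holdD:
  assumes "tapes_hold w \<beta> f"
  shows "track (f Work j) 0 \<longleftrightarrow> j < w" "track (f Work j) (Suc 0) \<longleftrightarrow> j = 0 \<and> 0 < w"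
    "track (f Work j) (Suc (Suc r)) \<longleftrightarrow> \<beta> r j" "w \<le> j \<Longrightarrow> \<not> \<beta> r j"
    "f Cat_Index j = 2 \<longleftrightarrow> \<beta> 0 j" "f Vertex_Arg j = 2 \<longleftrightarrow> \<beta> 1 j" "f Position_Arg j = 2 \<longleftrightarrow> \<beta> 2 j"
  using assms unfolding tapes_hold_def by (blast, blast, blast, meson not_le, blast, blast, blast)

definition conf_at :: "nat \<Rightarrow> nat \<Rightarrow> nat \<Rightarrow> (nat \<Rightarrow> nat \<Rightarrow> bool) \<Rightarrow> (nat \<Rightarrow> nat) \<Rightarrow> bool list \<Rightarrow>
    bool list \<Rightarrow> config \<Rightarrow> bool" where
  "conf_at q p w \<beta> A mem out c \<longleftrightarrow>
     state c = q \<and> pos c = (\<lambda>_. p) \<and> tapes_hold w \<beta> (cells c) \<and> cells c Answer = A \<and>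
     cat c = mem \<and> out_bits c = out"

lemma tapes_hold_write:
  assumes "tapes_hold w \<beta> f" "j \<le> w" "track s 0" "track s (Suc 0) \<longleftrightarrow> j = 0"
    "\<And>r. track s (Suc (Suc r)) \<longleftrightarrow> \<gamma> r"
  shows "tapes_hold (max w (Suc j)) (\<lambda>r k. if k = j then \<gamma> r else \<beta> r k)
    (\<lambda>x. if x = Answer then f x else (f x)(j := column_symbols s x))"
  unfolding tapes_hold_def
proof (intro allI, goal_cases)
  case (1 k)
  note hold = assms(1)[unfolded tapes_hold_def, rule_format, of k]
  show ?case
  proof (cases "k = j")
    case True
    then show ?thesis using assms(3-5) by (auto simp: numeral_2_eq_2)
  next
    case False
    moreover from False have "k < max w (Suc j) \<longleftrightarrow> k < w" "0 < max w (Suc j)"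
      "k = 0 \<and> 0 < w \<longleftrightarrow> k = 0" using assms(2) by auto
    ultimately show ?thesis using hold by simp
  qed
qed

lemma step_instr:
  assumes "state c = 6 * pc + u" "u < 6" "pc < length P"
  shows "step (instr_machine K P) I c =
    (case instr_step (P ! pc) pc u (\<lambda>x. cells c x (pos c x)) (reply c) of
       (q, a) \<Rightarrow> perform I a (c\<lparr>state := q\<rparr>))"
  using assms by (simp add: step_def instr_machine_def)

lemma perform_unchanged:
  "perform I (Tapes (\<lambda>x. cells c x (pos c x)) (\<lambda>_. d)) (c\<lparr>state := q\<rparr>) =
     Some (c\<lparr>state := q, pos := (\<lambda>x. move d (pos c x))\<rparr>)"
  by (cases c) (simp add: fun_eq_iff)

text \<open>Separates head movement from arithmetic. \<open>cy j\<close> is the memory on entering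
  column \<open>j\<close>; \<open>\<beta>\<close> and \<open>\<beta>'\<close> are the digits before
  and after. \<open>stop\<close> says that turning back at a column past the used cells leaves the
  complete result, and \<open>lim\<close> that this happens by column \<open>W\<close>.\<close>

locale sweeping =
  fixes K :: nat and P :: "instr list" and I :: graph_oracle and W pc :: nat and i :: instr
    and \<beta> \<beta>' :: "nat \<Rightarrow> nat \<Rightarrow> bool" and cy :: "nat \<Rightarrow> bool" and A :: "nat \<Rightarrow> nat" and w :: nat
    and fin :: bool
  assumes pc: "pc < length P" "P ! pc = i"
    and column: "\<And>j s. (\<And>r. track s (Suc (Suc r)) = \<beta> r j) \<Longrightarrow>
        fst (column (sweep_of i) (cy j) s (A j)) = cy (Suc j) \<and>
        (\<forall>r. track (snd (column (sweep_of i) (cy j) s (A j))) (Suc (Suc r)) = \<beta>' r j)"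
    and stop: "\<And>e. w \<le> e \<Longrightarrow> \<not> unfinished (sweep_of i) (cy e) (A e) \<Longrightarrow>
        cy e = fin \<and> (\<forall>r j. e \<le> j \<longrightarrow> \<beta>' r j = \<beta> r j)"
    and lim: "\<not> unfinished (sweep_of i) (cy W) (A W)" "w \<le> W" "1 \<le> W"
begin

abbreviation mixed :: "nat \<Rightarrow> nat \<Rightarrow> nat \<Rightarrow> bool" where
  "mixed e \<equiv> (\<lambda>r j. if j < e then \<beta>' r j else \<beta> r j)"

abbreviation M where "M \<equiv> instr_machine K P"

lemma column_perform:
  assumes c: "conf_at q j v (mixed j) A mem out c" and v: "j \<le> v" and first: "first \<longleftrightarrow> j = 0"
  obtains d where
    "(case column_step i pc first (cy j) (\<lambda>x. cells c x (pos c x)) of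
        (q, a) \<Rightarrow> perform I a (c\<lparr>state := q\<rparr>)) = Some d"
    "conf_at (6 * pc + (if cy (Suc j) then 2 else 1)) (Suc j) (max v (Suc j)) (mixed (Suc j))
       A mem out d"
proof -
  note c' = c[unfolded conf_at_def]
  have hold: "tapes_hold v (mixed j) (cells c)" using c' by simp
  have "\<And>r. track (cells c Work j) (Suc (Suc r)) = \<beta> r j"
    using tapes_holdD(3)[OF hold] by simp
  from column[OF this] have fst: "fst (column (sweep_of i) (cy j) (cells c Work j) (A j)) = cy (Suc j)"
    and snd: "\<forall>r. track (snd (column (sweep_of i) (cy j) (cells c Work j) (A j))) (Suc (Suc r)) = \<beta>' r j"
    by blast+
  define s where "s = snd (column (sweep_of i) (cy j) (cells c Work j) (A j))"
  have s: "column (sweep_of i) (cy j) (cells c Work j) (A j) = (cy (Suc j), s)"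
    "\<forall>r. track s (Suc (Suc r)) = \<beta>' r j"
    using fst snd by (simp_all add: s_def prod_eq_iff)
  define s' where "s' = put 0 True (put (Suc 0) first s)"
  have "tapes_hold (max v (Suc j)) (\<lambda>r k. if k = j then \<beta>' r j else mixed j r k)
      (\<lambda>x. if x = Answer then cells c x else (cells c x)(j := column_symbols s' x))"
    using hold v by (rule tapes_hold_write) (use s(2) first in \<open>auto simp: s'_def\<close>)
  moreover have "(\<lambda>r k. if k = j then \<beta>' r j else mixed j r k) = mixed (Suc j)"
    by (auto simp: fun_eq_iff less_Suc_eq)
  ultimately have hold': "tapes_hold (max v (Suc j)) (mixed (Suc j))
      (\<lambda>x. if x = Answer then cells c x else (cells c x)(j := column_symbols s' x))"
    by (simp only:)
  define d where "d = c\<lparr>state := 6 * pc + (if cy (Suc j) then 2 else 1),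
      cells := (\<lambda>x. if x = Answer then cells c x else (cells c x)(j := column_symbols s' x)),
      pos := (\<lambda>_. Suc j)\<rparr>"
  have "column_step i pc first (cy j) (\<lambda>x. cells c x (pos c x)) =
      (6 * pc + (if cy (Suc j) then 2 else 1), Tapes (column_symbols s') (\<lambda>_. Move_Right))"
    using c' s(1) by (simp add: column_step_def s'_def)
  then have "(case column_step i pc first (cy j) (\<lambda>x. cells c x (pos c x)) of
        (q, a) \<Rightarrow> perform I a (c\<lparr>state := q\<rparr>)) = Some d"
    using c' by (simp add: d_def cong: if_cong)
  moreover have "conf_at (6 * pc + (if cy (Suc j) then 2 else 1)) (Suc j) (max v (Suc j))
      (mixed (Suc j)) A mem out d"
    using hold' c' by (simp add: d_def conf_at_def)
  ultimately show ?thesis by (rule that)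
qed

lemma right:
  assumes "conf_at (6 * pc + (if cy j then 2 else 1)) j (max w j) (mixed j) A mem out c"
    and "1 \<le> j" "j \<le> W"
  shows "leads M I W (W - j + 1) c (\<lambda>d. \<exists>e v. e < W \<and> 1 \<le> v \<and> v \<le> W \<and>
     conf_at (6 * pc + (if fin then 4 else 3)) e v \<beta>' A mem out d)"
  using assms
proof (induction "W - j" arbitrary: j c rule: less_induct)
  case less
  note c = less.prems(1)
  note c' = c[unfolded conf_at_def]
  have hold: "tapes_hold (max w j) (mixed j) (cells c)" using c' by simp
  define u :: nat where "u = (if cy j then 2 else 1)"
  have step: "step M I c = (case instr_step i pc u (\<lambda>x. cells c x (pos c x)) (reply c) of
       (q, a) \<Rightarrow> perform I a (c\<lparr>state := q\<rparr>))"
    using step_instr[of c pc u P K I] pc c' by (auto simp: u_def)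
  have istep: "instr_step i pc u r b = right_step i pc (cy j) r" for r b
    by (simp add: instr_step_def u_def)
  have posW: "\<forall>x. pos c x \<le> W" using c' less.prems by simp
  show ?case
  proof (cases "track (cells c Work j) 0 \<or> unfinished (sweep_of i) (cy j) (A j)")
    case True
    \<comment> \<open>At column \<open>W\<close> neither reason to go on is left: the cells in use
      end there, and \<open>lim\<close> excludes a pending carry or digit.\<close>
    have j: "j < W"
    proof (rule ccontr)
      assume "\<not> j < W"
      then have "j = W" using less.prems by simp
      then show False using True lim tapes_holdD(1)[OF hold, of j] by (simp add: max_def)
    qed
    obtain d where d: "step M I c = Some d"
      "conf_at (6 * pc + (if cy (Suc j) then 2 else 1)) (Suc j) (max (max w j) (Suc j))
         (mixed (Suc j)) A mem out d"
    proof (rule column_perform[OF c, of False])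
      have "right_step i pc (cy j) (\<lambda>x. cells c x (pos c x)) =
          column_step i pc False (cy j) (\<lambda>x. cells c x (pos c x))"
        using True c' by (auto simp: right_step_def)
      then have st: "step M I c = (case column_step i pc False (cy j) (\<lambda>x. cells c x (pos c x)) of
          (q, a) \<Rightarrow> perform I a (c\<lparr>state := q\<rparr>))"
        by (simp only: step istep)
      fix d
      assume "(case column_step i pc False (cy j) (\<lambda>x. cells c x (pos c x)) of
          (q, a) \<Rightarrow> perform I a (c\<lparr>state := q\<rparr>)) = Some d"
        "conf_at (6 * pc + (if cy (Suc j) then 2 else 1)) (Suc j) (max (max w j) (Suc j))
         (mixed (Suc j)) A mem out d"
      then show thesis using that[of d] st by (simp only:)
    qed (use less.prems in auto)
    have "leads M I W (W - Suc j + 1) d (\<lambda>d. \<exists>e v. e < W \<and> 1 \<le> v \<and> v \<le> W \<and>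
     conf_at (6 * pc + (if fin then 4 else 3)) e v \<beta>' A mem out d)"
      using d(2) j by (intro less.hyps) (auto simp: max.assoc)
    from leads_step[OF d(1) posW this] show ?thesis using j by (simp add: Suc_diff_Suc)
  next
    case False
    then have "w \<le> j" using tapes_holdD(1)[OF hold, of j] by auto
    with stop[of j] False have fin: "cy j = fin" and eq: "\<forall>r k. j \<le> k \<longrightarrow> \<beta>' r k = \<beta> r k"
      by auto
    let ?d = "c\<lparr>state := 6 * pc + (if fin then 4 else 3), pos := (\<lambda>x. move Move_Left (pos c x))\<rparr>"
    have "mixed j = \<beta>'" using eq by (auto simp: fun_eq_iff)
    then have d: "conf_at (6 * pc + (if fin then 4 else 3)) (j - 1) (max w j) \<beta>' A mem out ?d"
      using c' by (simp add: conf_at_def)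
    have "right_step i pc (cy j) (\<lambda>x. cells c x (pos c x)) =
        (6 * pc + (if fin then 4 else 3), Tapes (\<lambda>x. cells c x (pos c x)) (\<lambda>_. Move_Left))"
      using False c' by (simp add: right_step_def fin)
    then have st: "step M I c = Some ?d" by (simp only: step istep prod.case perform_unchanged)
    have "j - 1 < W" "1 \<le> max w j" "max w j \<le> W" using less.prems lim by auto
    with d have "\<exists>e v. e < W \<and> 1 \<le> v \<and> v \<le> W \<and>
        conf_at (6 * pc + (if fin then 4 else 3)) e v \<beta>' A mem out ?d" by blast
    moreover have "\<forall>x. pos ?d x \<le> W" using d \<open>j - 1 < W\<close> unfolding conf_at_def by simp
    ultimately have "leads M I W 0 ?d (\<lambda>d. \<exists>e v. e < W \<and> 1 \<le> v \<and> v \<le> W \<and>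
        conf_at (6 * pc + (if fin then 4 else 3)) e v \<beta>' A mem out d)"
      by (rule leads_refl)
    from leads_step[OF st posW this]
    show ?thesis by (rule leads_mono) auto
  qed
qed

lemma left:
  assumes "conf_at (6 * pc + (if fin then 4 else 3)) e v \<beta>' A mem out c" "e \<le> W" "1 \<le> v"
  shows "leads M I W (e + 1) c (conf_at (6 * next_pc i pc fin) 0 v \<beta>' A mem out)"
  using assms
proof (induction e arbitrary: c)
  case 0
  note c' = 0(1)[unfolded conf_at_def]
  have hold: "tapes_hold v \<beta>' (cells c)" using c' by simp
  have posW: "\<forall>x. pos c x \<le> W" using c' by simp
  let ?d = "c\<lparr>state := 6 * next_pc i pc fin, pos := (\<lambda>x. move Stay (pos c x))\<rparr>"
  have "step M I c = (case instr_step i pc (if fin then 4 else 3) (\<lambda>x. cells c x (pos c x)) (reply c) of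
       (q, a) \<Rightarrow> perform I a (c\<lparr>state := q\<rparr>))"
    using step_instr[of c pc "if fin then 4 else 3" P K I] pc c' by auto
  also have "\<dots> = Some ?d"
  proof -
    have "instr_step i pc (if fin then 4 else 3) (\<lambda>x. cells c x (pos c x)) (reply c) =
        (6 * next_pc i pc fin, Tapes (\<lambda>x. cells c x (pos c x)) (\<lambda>_. Stay))"
      using tapes_holdD(2)[OF hold, of 0] c' 0(3) by (simp add: instr_step_def left_step_def)
    then show ?thesis by (simp only: prod.case perform_unchanged)
  qed
  finally have st: "step M I c = Some ?d" .
  have d: "conf_at (6 * next_pc i pc fin) 0 v \<beta>' A mem out ?d"
    using c' by (simp add: conf_at_def)
  then have "\<forall>x. pos ?d x \<le> W" unfolding conf_at_def by simp
  with d have "leads M I W 0 ?d (conf_at (6 * next_pc i pc fin) 0 v \<beta>' A mem out)"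
    by (rule leads_refl)
  from leads_step[OF st posW this] show ?case by simp
next
  case (Suc e)
  note c' = Suc.prems(1)[unfolded conf_at_def]
  have hold: "tapes_hold v \<beta>' (cells c)" using c' by simp
  have posW: "\<forall>x. pos c x \<le> W" using c' Suc.prems by simp
  let ?d = "c\<lparr>state := 6 * pc + (if fin then 4 else 3), pos := (\<lambda>x. move Move_Left (pos c x))\<rparr>"
  have "step M I c = (case instr_step i pc (if fin then 4 else 3) (\<lambda>x. cells c x (pos c x)) (reply c) of
       (q, a) \<Rightarrow> perform I a (c\<lparr>state := q\<rparr>))"
    using step_instr[of c pc "if fin then 4 else 3" P K I] pc c' by auto
  also have "\<dots> = Some ?d"
  proof -
    have "instr_step i pc (if fin then 4 else 3) (\<lambda>x. cells c x (pos c x)) (reply c) =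
        (6 * pc + (if fin then 4 else 3), Tapes (\<lambda>x. cells c x (pos c x)) (\<lambda>_. Move_Left))"
      using tapes_holdD(2)[OF hold, of "Suc e"] c' by (simp add: instr_step_def left_step_def)
    then show ?thesis by (simp only: prod.case perform_unchanged)
  qed
  finally have st: "step M I c = Some ?d" .
  have "conf_at (6 * pc + (if fin then 4 else 3)) e v \<beta>' A mem out ?d"
    using c' by (simp add: conf_at_def)
  from leads_step[OF st posW Suc.IH[OF this]] Suc.prems show ?case by simp
qed

text \<open>Column 0 takes one step, the rest of the way to the right including the turn at most
  \<open>W\<close>, and the return at most \<open>W\<close>. Column 0 is processed unconditionally
  because on blank tapes it is not yet marked as used.\<close>

lemma sweep:
  assumes c: "conf_at q 0 w \<beta> A mem out c"
    and st: "step M I c = (case column_step i pc True (cy 0) (\<lambda>x. cells c x (pos c x)) of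
        (q, a) \<Rightarrow> perform I a (c\<lparr>state := q\<rparr>))"
  shows "leads M I W (2 * W + 1) c
    (\<lambda>d. \<exists>v\<le>W. conf_at (6 * next_pc i pc fin) 0 v \<beta>' A mem out d)"
proof -
  have "conf_at q 0 w (mixed 0) A mem out c" using c by simp
  then obtain d where d: "step M I c = Some d"
    "conf_at (6 * pc + (if cy (Suc 0) then 2 else 1)) (Suc 0) (max w (Suc 0)) (mixed (Suc 0)) A mem out d"
    unfolding st by (rule column_perform[of q 0 w mem out c True]) simp_all
  have posW: "\<forall>x. pos c x \<le> W" using c by (simp add: conf_at_def)
  have "leads M I W (W - Suc 0 + 1 + W) d
      (\<lambda>d. \<exists>v\<le>W. conf_at (6 * next_pc i pc fin) 0 v \<beta>' A mem out d)"
  proof (rule leads_trans[OF right[OF d(2)]])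
    fix d'
    assume "\<exists>e v. e < W \<and> 1 \<le> v \<and> v \<le> W \<and>
      conf_at (6 * pc + (if fin then 4 else 3)) e v \<beta>' A mem out d'"
    then obtain e v where "e < W" "1 \<le> v" "v \<le> W"
      "conf_at (6 * pc + (if fin then 4 else 3)) e v \<beta>' A mem out d'" by blast
    then have "leads M I W (e + 1) d' (conf_at (6 * next_pc i pc fin) 0 v \<beta>' A mem out)"
      by (intro left) auto
    then show "leads M I W W d' (\<lambda>d. \<exists>v\<le>W. conf_at (6 * next_pc i pc fin) 0 v \<beta>' A mem out d)"
      by (rule leads_mono) (use \<open>e < W\<close> \<open>v \<le> W\<close> in auto)
  qed (use lim in auto)
  from leads_step[OF d(1) posW this] show ?thesis by (rule leads_mono) (use lim in auto)
qed

end

section \<open>Correctness of an instruction\<close>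

text \<open>The carry into column \<open>j\<close> of \<open>x + y + c\<close>, as overflow of the
  low parts. This form covers negative integers in two's complement and shows directly when no carry
  is left; the recursion that the machine follows is \<open>carry_Suc\<close>.\<close>

definition carry :: "bool \<Rightarrow> int \<Rightarrow> int \<Rightarrow> nat \<Rightarrow> bool" where
  "carry c x y j \<longleftrightarrow> 2 ^ j \<le> take_bit j x + take_bit j y + of_bool c"

definition borrow :: "int \<Rightarrow> int \<Rightarrow> nat \<Rightarrow> bool" where
  "borrow x y j \<longleftrightarrow> take_bit j x < take_bit j y"

lemma carry_0 [simp]: "carry c x y 0 = c"
  by (simp add: carry_def)

lemma borrow_0 [simp]: "\<not> borrow x y 0"
  by (simp add: borrow_def)

lemma take_bit_int_cases:
  obtains t where "take_bit j (x::int) = t" "0 \<le> t" "t < 2 ^ j"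
  by simp

lemma carry_Suc:
  "carry c x y (Suc j) \<longleftrightarrow>
     (bit x j \<and> bit y j) \<or> (carry c x y j \<and> (bit x j \<or> bit y j))"
  by (rule take_bit_int_cases[of j x], rule take_bit_int_cases[of j y])
    (auto simp: carry_def take_bit_Suc_from_most of_bool_def)

lemma borrow_Suc:
  "borrow x y (Suc j) \<longleftrightarrow> (if bit x j = bit y j then borrow x y j else bit y j)"
  by (rule take_bit_int_cases[of j x], rule take_bit_int_cases[of j y])
    (auto simp: borrow_def take_bit_Suc_from_most of_bool_def)

lemma bit_int_split:
  fixes z :: int
  assumes "z = r + 2 ^ j * q" "0 \<le> r" "r < 2 ^ j"
  shows "bit z j \<longleftrightarrow> odd q"
proof -
  have "z div 2 ^ j = q" using assms by (simp add: div_pos_pos_trivial)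
  then show ?thesis by (simp add: bit_iff_odd)
qed

text \<open>Once the overflow is moved out, the low parts contribute a remainder in
  \<open>[0, 2 ^ j)\<close>, so digit \<open>j\<close> is the parity of the two quotients plus the
  carry.\<close>

lemma bit_add_carry:
  "bit (x + y + of_bool c) j \<longleftrightarrow> (bit x j \<noteq> (bit y j \<noteq> carry c x y j))"
proof -
  have x: "x = take_bit j x + 2 ^ j * (x div 2 ^ j)" and y: "y = take_bit j y + 2 ^ j * (y div 2 ^ j)"
    by (simp_all add: take_bit_eq_mod)
  let ?s = "take_bit j x + take_bit j y + of_bool c"
  have "x + y + of_bool c = ?s - 2 ^ j * of_bool (carry c x y j)
      + 2 ^ j * (x div 2 ^ j + y div 2 ^ j + of_bool (carry c x y j))"
    by (subst x, subst y) (simp add: algebra_simps)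
  moreover have "0 \<le> ?s - 2 ^ j * of_bool (carry c x y j)"
    by (rule take_bit_int_cases[of j x], rule take_bit_int_cases[of j y])
      (auto simp: carry_def of_bool_def)
  moreover have "?s - 2 ^ j * of_bool (carry c x y j) < 2 ^ j"
    by (rule take_bit_int_cases[of j x], rule take_bit_int_cases[of j y])
      (auto simp: carry_def of_bool_def)
  ultimately have "bit (x + y + of_bool c) j \<longleftrightarrow>
      odd (x div 2 ^ j + y div 2 ^ j + of_bool (carry c x y j))"
    by (rule bit_int_split)
  then show ?thesis by (auto simp: bit_iff_odd)
qed

lemma bit_diff_borrow:
  "bit (x - y) j \<longleftrightarrow> (bit x j \<noteq> (bit y j \<noteq> borrow x y j))"
proof -
  have x: "x = take_bit j x + 2 ^ j * (x div 2 ^ j)" and y: "y = take_bit j y + 2 ^ j * (y div 2 ^ j)"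
    by (simp_all add: take_bit_eq_mod)
  let ?s = "take_bit j x - take_bit j y"
  have "x - y = ?s + 2 ^ j * of_bool (borrow x y j)
      + 2 ^ j * (x div 2 ^ j - y div 2 ^ j - of_bool (borrow x y j))"
    by (subst x, subst y) (simp add: algebra_simps)
  moreover have "0 \<le> ?s + 2 ^ j * of_bool (borrow x y j)"
    by (rule take_bit_int_cases[of j x], rule take_bit_int_cases[of j y])
      (auto simp: borrow_def of_bool_def)
  moreover have "?s + 2 ^ j * of_bool (borrow x y j) < 2 ^ j"
    by (rule take_bit_int_cases[of j x], rule take_bit_int_cases[of j y])
      (auto simp: borrow_def of_bool_def)
  ultimately have "bit (x - y) j \<longleftrightarrow> odd (x div 2 ^ j - y div 2 ^ j - of_bool (borrow x y j))"
    by (rule bit_int_split)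
  then show ?thesis by (auto simp: bit_iff_odd)
qed

lemma sum_bits: "(\<Sum>j | bit x j. 2 ^ j) = (x::nat)"
proof -
  obtain k where k: "x < 2 ^ k" using less_exp by blast
  have "(\<Sum>j | bit x j. 2 ^ j) = (\<Sum>j<k. of_bool (bit x j) * (2::nat) ^ j)"
    using k nat_less_power_iff_bit[of x k]
    by (intro sum.mono_neutral_cong_left) (auto simp: not_le[symmetric])
  also have "\<dots> = take_bit k x"
    by (induction k) (simp_all add: take_bit_Suc_from_most)
  finally show ?thesis using k by (simp add: take_bit_nat_eq_self)
qed

lemma tape_number_bits:
  assumes "\<And>j. f j = 2 \<longleftrightarrow> bit x j"
  shows "tape_number f = x"
  using sum_bits[of x] by (simp add: tape_number_def assms)

section \<open>Semantics of instructions on an abstract store\<close>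

type_synonym store = "(nat \<Rightarrow> nat) \<times> bool list \<times> bool list"

text \<open>Registers are unbounded here; that their values fit into \<open>W\<close> cells is a
  separate obligation, \<open>bounded\<close>. \<open>Write\<close> stores a parity, so it extracts
  the sum digit of a column without any masking.\<close>

fun effect :: "graph_oracle \<Rightarrow> instr \<Rightarrow> store \<Rightarrow> store" where
  "effect I (Arith a keep b cin) (R, mem, out) =
     (R(a := (if keep then R a else 0) + (case b of None \<Rightarrow> 0 | Some b \<Rightarrow> R b) + of_bool cin), mem, out)"
| "effect I (Read a) (R, mem, out) = (R(a := of_bool (mem ! R 0)), mem, out)"
| "effect I (Write a) (R, mem, out) = (R, mem[R 0 := odd (R a)], out)"
| "effect I (Query k a) (R, mem, out) =
     (R(a := (case answer_to I k (R 1) (R 2) of None \<Rightarrow> 0 | Some x \<Rightarrow> x)), mem, out)"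
| "effect I (Out b) (R, mem, out) = (R, mem, out @ [b])"
| "effect I (Jump_Unless_Less a b l) S = S"

fun enabled :: "instr \<Rightarrow> store \<Rightarrow> bool" where
  "enabled (Read a) (R, mem, out) \<longleftrightarrow> R 0 < length mem"
| "enabled (Write a) (R, mem, out) \<longleftrightarrow> R 0 < length mem"
| "enabled i S \<longleftrightarrow> True"

definition bounded :: "nat \<Rightarrow> store \<Rightarrow> bool" where
  "bounded W S \<longleftrightarrow> (\<forall>r. fst S r < 2 ^ W)"

definition represents :: "nat \<Rightarrow> nat \<Rightarrow> store \<Rightarrow> config \<Rightarrow> bool" where
  "represents W pc S c \<longleftrightarrow>
     bounded W S \<and>
     (\<exists>w\<le>W. \<exists>A. conf_at (6 * pc) 0 w (\<lambda>r. bit (fst S r)) A (fst (snd S)) (snd (snd S)) c)"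

fun operand_value :: "operand \<Rightarrow> (nat \<Rightarrow> nat) \<Rightarrow> nat \<Rightarrow> nat" where
  "operand_value Nil_Op R z = 0"
| "operand_value (Reg_Op b) R z = R b"
| "operand_value Answer_Op R z = z"

lemma number_tape_eq_2 [simp]: "number_tape z j = 2 \<longleftrightarrow> bit z j"
proof -
  have "bit z j \<Longrightarrow> j < floorlog 2 z"
  proof (rule ccontr)
    assume b: "bit z j" and "\<not> j < floorlog 2 z"
    moreover have "z < 2 ^ floorlog 2 z"
      using floorlog_bounds[of z 2] by (cases "z = 0") auto
    ultimately show False using nat_less_power_iff_bit[of z "floorlog 2 z"] by auto
  qed
  then show ?thesis by (auto simp: number_tape_def)
qed

lemma number_tape_eq_0: "number_tape z j = 0 \<longleftrightarrow> z < 2 ^ j"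
  using floorlog_le_iff[of 2 z j] by (auto simp: number_tape_def)

text \<open>Turning back at column \<open>e\<close> is sound because all operands are then below
  \<open>2 ^ e\<close> and no carry is left: the result is below \<open>2 ^ e\<close> too, and the
  columns from \<open>e\<close> on are 0 before and after. The bound \<open>v < 2 ^ W\<close> forces
  this to happen by column \<open>W\<close>.\<close>

lemma sweeping_add:
  assumes "pc < length P" "P ! pc = i" "sweep_of i = Add a keep src"
    and "\<And>r j. w \<le> j \<Longrightarrow> \<not> bit (R r) j" "w \<le> W" "1 \<le> W"
    and "src = Answer_Op \<Longrightarrow> A = number_tape z"
    and v: "v = (if keep then R a else 0) + operand_value src R z + of_bool cin" "v < 2 ^ W"
  shows "sweeping P W pc i (\<lambda>r. bit (R r)) (\<lambda>r. bit ((R(a := v)) r))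
    (carry cin (int (if keep then R a else 0)) (int (operand_value src R z))) A w False"
proof -
  define x where "x = (if keep then R a else 0)"
  define y where "y = operand_value src R z"
  have vi: "int v = int x + int y + of_bool cin" by (simp add: v x_def y_def)
  have y_bit: "operand_bit src s (A j) = bit y j"
    if "\<And>r. track s (Suc (Suc r)) = bit (R r) j" for s j
    using that assms(7) by (cases src) (auto simp: y_def)
  have x_bit: "(keep \<and> track s (Suc (Suc a))) = bit x j"
    if "\<And>r. track s (Suc (Suc r)) = bit (R r) j" for s j
    using that by (auto simp: x_def)
  have settled: "\<not> carry cin (int x) (int y) j" if "v < 2 ^ j" for j
  proof -
    have "int v < 2 ^ j" using that by (metis of_nat_less_iff of_nat_numeral of_nat_power)
    moreover have "take_bit j (int x) + take_bit j (int y) \<le> int x + int y"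
      by (intro add_mono) (simp_all add: take_bit_int_less_eq_self_iff)
    ultimately show ?thesis using vi by (auto simp: carry_def)
  qed
  show ?thesis
    unfolding x_def[symmetric] y_def[symmetric]
  proof
    show "pc < length P" "P ! pc = i" "w \<le> W" "1 \<le> W" by fact+
    fix j s
    assume s: "\<And>r. track s (Suc (Suc r)) = bit (R r) j"
    have "bit v j \<longleftrightarrow> (bit x j \<noteq> (bit y j \<noteq> carry cin (int x) (int y) j))"
      using bit_add_carry[of "int x" "int y" cin j] unfolding vi[symmetric]
      by (simp add: bit_of_nat_iff_bit)
    then have "column (sweep_of i) (carry cin (int x) (int y) j) s (A j) =
        (carry cin (int x) (int y) (Suc j), put (Suc (Suc a)) (bit v j) s)"
      by (simp only: assms(3) column.simps Let_def y_bit[OF s] x_bit[OF s] carry_Suc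
          bit_of_nat_iff_bit)
    then show "fst (column (sweep_of i) (carry cin (int x) (int y) j) s (A j)) =
        carry cin (int x) (int y) (Suc j) \<and>
      (\<forall>r. track (snd (column (sweep_of i) (carry cin (int x) (int y) j) s (A j))) (Suc (Suc r)) =
        bit ((R(a := v)) r) j)"
      by (simp add: s)
  next
    fix e
    assume e: "w \<le> e" "\<not> unfinished (sweep_of i) (carry cin (int x) (int y) e) (A e)"
    then have c: "\<not> carry cin (int x) (int y) e" by (simp add: assms(3))
    have small: "R r < 2 ^ e" for r
      using assms(4) e(1) nat_less_power_iff_bit by auto
    have "y < 2 ^ e"
      using e(2) small assms(7) by (cases src) (auto simp: y_def assms(3) number_tape_eq_0)
    moreover have "x < 2 ^ e" using small by (simp add: x_def)
    ultimately have "int v < 2 ^ e" using c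
      by (simp add: carry_def vi take_bit_int_eq_self)
    then have "v < 2 ^ e" by (metis of_nat_less_iff of_nat_numeral of_nat_power)
    then have "\<not> bit v j" if "e \<le> j" for j using that nat_less_power_iff_bit by auto
    then show "carry cin (int x) (int y) e = False \<and>
        (\<forall>r j. e \<le> j \<longrightarrow> bit ((R(a := v)) r) j = bit (R r) j)"
      using c assms(4) e(1) by auto
  next
    have "src = Answer_Op \<Longrightarrow> A W = 0"
      using v assms(7) by (auto simp: number_tape_eq_0)
    then show "\<not> unfinished (sweep_of i) (carry cin (int x) (int y) W) (A W)"
      using settled[OF v(2)] by (simp add: assms(3))
  qed
qed

lemma sweeping_compare:
  assumes "pc < length P" "P ! pc = i" "sweep_of i = Compare a b"
    and "\<And>r j. w \<le> j \<Longrightarrow> \<not> bit (R r) j" "w \<le> W" "1 \<le> W"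
  shows "sweeping P W pc i (\<lambda>r. bit (R r)) (\<lambda>r. bit (R r))
    (borrow (int (R a)) (int (R b))) A w (R a < R b)"
proof
  show "pc < length P" "P ! pc = i" "w \<le> W" "1 \<le> W" by fact+
  fix j s
  assume s: "\<And>r. track s (Suc (Suc r)) = bit (R r) j"
  then show "fst (column (sweep_of i) (borrow (int (R a)) (int (R b)) j) s (A j)) =
        borrow (int (R a)) (int (R b)) (Suc j) \<and>
      (\<forall>r. track (snd (column (sweep_of i) (borrow (int (R a)) (int (R b)) j) s (A j))) (Suc (Suc r)) =
        bit (R r) j)"
    by (auto simp: assms(3) Let_def borrow_Suc bit_of_nat_iff_bit)
next
  fix e
  assume e: "w \<le> e"
  have "R r < 2 ^ e" for r
    using assms(4) e nat_less_power_iff_bit by auto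
  then show "borrow (int (R a)) (int (R b)) e = (R a < R b) \<and>
      (\<forall>r j. e \<le> j \<longrightarrow> bit (R r) j = bit (R r) j)"
    by (simp add: borrow_def take_bit_int_eq_self)
qed (simp add: assms(3))

lemma represents_conf:
  assumes "conf_at (6 * pc) 0 w (\<lambda>r. bit (R r)) A mem out c" "w \<le> W" "\<And>r. R r < 2 ^ W"
  shows "represents W pc (R, mem, out) c"
  using assms by (auto simp: represents_def bounded_def)

text \<open>The worst case is a query or a catalytic read: one step for the reply and a sweep of
  \<open>2 * W + 1\<close> steps that stores it. Charging every instruction this amount lets
  programs simply count instructions.\<close>

lemma leads_instr:
  assumes pc: "pc < length P" "P ! pc = i" and c: "represents W pc S c" and W: "1 \<le> W"
    and ok: "enabled i S" "bounded W (effect I i S)"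
  shows "leads (instr_machine K P) I W (2 * W + 2) c
    (represents W (next_pc i pc (case i of Jump_Unless_Less a b l \<Rightarrow> fst S a < fst S b | _ \<Rightarrow> False))
       (effect I i S))"
proof -
  obtain R mem out where S: "S = (R, mem, out)" by (metis prod.collapse)
  obtain w A where w: "w \<le> W" and conf: "conf_at (6 * pc) 0 w (\<lambda>r. bit (R r)) A mem out c"
    using c by (auto simp: represents_def S)
  note conf' = conf[unfolded conf_at_def]
  have hold: "tapes_hold w (\<lambda>r. bit (R r)) (cells c)" using conf' by simp
  have idle: "\<not> bit (R r) j" if "w \<le> j" for r j
    using tapes_holdD(4)[OF hold that] .
  have R_less: "R r < 2 ^ W" for r using c by (simp add: represents_def bounded_def S)
  have posW: "\<forall>x. pos c x \<le> W" using conf' by simp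
  have step: "step (instr_machine K P) I c = (case entry_step i pc (\<lambda>x. cells c x (pos c x)) of
       (q, a) \<Rightarrow> perform I a (c\<lparr>state := q\<rparr>))"
    using step_instr[of c pc 0 P K I] conf' pc by (simp add: instr_step_def)
  have addr: "tape_number (cells c Cat_Index) = R 0" "tape_number (cells c Vertex_Arg) = R 1"
    "tape_number (cells c Position_Arg) = R 2"
    using tapes_holdD(5-7)[OF hold] by (auto intro!: tape_number_bits)
  have finish: "leads (instr_machine K P) I W (2 * W + 2) c (represents W (Suc pc) (R', mem', out'))"
    if "perform I a (c\<lparr>state := 6 * Suc pc\<rparr>) = Some d" "entry_step i pc (\<lambda>x. cells c x (pos c x)) = (6 * Suc pc, a)"
      "conf_at (6 * Suc pc) 0 w (\<lambda>r. bit (R' r)) A mem' out' d" "\<And>r. R' r < 2 ^ W"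
    for a d R' mem' out'
  proof -
    have "represents W (Suc pc) (R', mem', out') d"
      using that(3) w that(4) by (rule represents_conf)
    moreover have "\<forall>x. pos d x \<le> W" using that(3) by (simp add: conf_at_def)
    ultimately have "leads (instr_machine K P) I W 0 d (represents W (Suc pc) (R', mem', out'))"
      by (rule leads_refl)
    from leads_step[OF _ posW this] step that(1,2)
    show ?thesis by (auto elim: leads_mono simp del: perform.simps)
  qed
  have sweep1: "leads (instr_machine K P) I W (2 * W + 2) c
      (represents W (next_pc i pc fin) (R', mem, out))"
    if "sweeping P W pc i (\<lambda>r. bit (R r)) (\<lambda>r. bit (R' r)) cy A w fin"
      "entry_step i pc (\<lambda>x. cells c x (pos c x)) = column_step i pc True (cy 0) (\<lambda>x. cells c x (pos c x))"
      "\<And>r. R' r < 2 ^ W" for R' cy fin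
  proof -
    interpret sweeping K P I W pc i "\<lambda>r. bit (R r)" "\<lambda>r. bit (R' r)" cy A w fin by fact
    show ?thesis
      by (rule leads_mono[OF sweep[OF conf step[unfolded that(2)]]])
        (use that(3) in \<open>auto intro: represents_conf\<close>)
  qed
  have sweep2: "leads (instr_machine K P) I W (2 * W + 2) c
      (represents W (next_pc i pc fin) (R', mem, out))"
    if "sweeping P W pc i (\<lambda>r. bit (R r)) (\<lambda>r. bit (R' r)) cy A' w fin"
      "entry_step i pc (\<lambda>x. cells c x (pos c x)) = (6 * pc + 5, a)"
      "perform I a (c\<lparr>state := 6 * pc + 5\<rparr>) = Some d"
      "conf_at (6 * pc + 5) 0 w (\<lambda>r. bit (R r)) A' mem out d"
      "second_carry i (reply d) = cy 0"
      "\<And>r. R' r < 2 ^ W" for a R' cy fin A' d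
  proof -
    interpret sweeping K P I W pc i "\<lambda>r. bit (R r)" "\<lambda>r. bit (R' r)" cy A' w fin by fact
    have d: "step (instr_machine K P) I c = Some d" using step that(2,3) by simp
    have "step (instr_machine K P) I d = (case instr_step i pc 5 (\<lambda>x. cells d x (pos d x)) (reply d) of
       (q, a) \<Rightarrow> perform I a (d\<lparr>state := q\<rparr>))"
      using step_instr[of d pc 5 P K I] that(4) pc unfolding conf_at_def by simp
    then have "step (instr_machine K P) I d = (case column_step i pc True (cy 0) (\<lambda>x. cells d x (pos d x)) of
       (q, a) \<Rightarrow> perform I a (d\<lparr>state := q\<rparr>))"
      using that(5) by (simp add: instr_step_def)
    from leads_step[OF d posW sweep[OF that(4) this]] show ?thesis
      by (rule leads_mono) (use that(6) in \<open>auto intro: represents_conf\<close>)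
  qed
  show ?thesis
  proof (cases i)
    case (Arith a keep b cin)
    define src where "src = (case b of None \<Rightarrow> Nil_Op | Some b \<Rightarrow> Reg_Op b)"
    define v where "v = (if keep then R a else 0) + operand_value src R 0 + of_bool cin"
    have eff: "effect I i S = (R(a := v), mem, out)"
      by (cases b) (auto simp: Arith S v_def src_def)
    have less: "(R(a := v)) r < 2 ^ W" for r using ok(2) eff by (simp add: bounded_def)
    from less[of a] have "v < 2 ^ W" by simp
    then have "sweeping P W pc i (\<lambda>r. bit (R r)) (\<lambda>r. bit ((R(a := v)) r))
      (carry cin (int (if keep then R a else 0)) (int (operand_value src R 0))) A w False"
      by (intro sweeping_add pc idle w W)
        (auto simp: Arith src_def v_def split: option.splits)
    from sweep1[OF this _ less] show ?thesis unfolding eff by (simp add: Arith del: fun_upd_apply)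
  next
    case (Read a)
    have m: "R 0 < length mem" using ok(1) by (simp add: S Read)
    define v :: nat where "v = of_bool (mem ! R 0)"
    have eff: "effect I i S = (R(a := v), mem, out)" by (simp add: Read S v_def)
    have less: "(R(a := v)) r < 2 ^ W" for r using ok(2) eff by (simp add: bounded_def)
    from less[of a] have "v < 2 ^ W" by simp
    then have "sweeping P W pc i (\<lambda>r. bit (R r)) (\<lambda>r. bit ((R(a := v)) r))
      (carry (mem ! R 0) (int (if False then R a else 0)) (int (operand_value Nil_Op R 0))) A w False"
      by (intro sweeping_add pc idle w W) (auto simp: Read v_def)
    from sweep2[OF this _ _ _ _ less, of Cat_Read "c\<lparr>state := 6 * pc + 5, reply := mem ! R 0\<rparr>"]
    show ?thesis unfolding eff using conf' m by (simp add: Read addr conf_at_def del: fun_upd_apply)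
  next
    case (Write a)
    have m: "R 0 < length mem" using ok(1) by (simp add: S Write)
    have odd: "track (cells c Work 0) (Suc (Suc a)) = odd (R a)"
      using tapes_holdD(3)[OF hold] by (simp add: bit_0)
    from finish[of "Cat_Write (odd (R a))" "c\<lparr>state := 6 * Suc pc, cat := mem[R 0 := odd (R a)]\<rparr>" R
        "mem[R 0 := odd (R a)]" out] R_less
    show ?thesis using conf' m odd by (simp add: Write S addr conf_at_def)
  next
    case (Query k a)
    define z where "z = (case answer_to I k (R 1) (R 2) of None \<Rightarrow> 0 | Some x \<Rightarrow> x)"
    have eff: "effect I i S = (R(a := z), mem, out)" by (simp add: Query S z_def)
    have less: "(R(a := z)) r < 2 ^ W" for r using ok(2) eff by (simp add: bounded_def)
    from less[of a] have "z < 2 ^ W" by simp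
    then have sw: "sweeping P W pc i (\<lambda>r. bit (R r)) (\<lambda>r. bit ((R(a := z)) r))
      (carry False (int (if False then R a else 0)) (int (operand_value Answer_Op R z)))
      (number_tape z) w False"
      by (intro sweeping_add pc idle w W) (auto simp: Query)
    define d where "d = c\<lparr>state := 6 * pc + 5,
      reply := (answer_to I k (R 1) (R 2) \<noteq> None), cells := (cells c)(Answer := number_tape z)\<rparr>"
    \<comment> \<open>An absent object leaves the answer tape blank, and blank is also the notation
      of 0, so storing 0 is right in that case.\<close>
    have blank: "number_tape 0 = (\<lambda>_. 0)" by (simp add: fun_eq_iff number_tape_def floorlog_def)
    have "perform I (Ask k) (c\<lparr>state := 6 * pc + 5\<rparr>) = Some d"
      using addr by (auto simp: d_def z_def blank split: option.splits)
    moreover have "conf_at (6 * pc + 5) 0 w (\<lambda>r. bit (R r)) (number_tape z) mem out d"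
      using conf' unfolding conf_at_def tapes_hold_def by (simp add: d_def)
    ultimately show ?thesis
      unfolding eff using sweep2[OF sw _ _ _ _ less, of "Ask k" d] by (simp add: Query del: fun_upd_apply)
  next
    case (Out b)
    from finish[of "Emit b" "c\<lparr>state := 6 * Suc pc, out_bits := out @ [b]\<rparr>" R mem "out @ [b]"] R_less
    show ?thesis using conf' by (simp add: Out S conf_at_def)
  next
    case (Jump_Unless_Less a b l)
    have "sweeping P W pc i (\<lambda>r. bit (R r)) (\<lambda>r. bit (R r))
      (borrow (int (R a)) (int (R b))) A w (R a < R b)"
      by (intro sweeping_compare pc idle w W) (auto simp: Jump_Unless_Less)
    from sweep1[OF this _ R_less] show ?thesis by (simp add: Jump_Unless_Less S)
  qed
qed

section \<open>Structured programs\<close>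

datatype com =
  Skip
| Ins instr
| Seq com com (infixr ";;" 60)
| If_Less nat nat com com
| While_Less nat nat com

fun code_length :: "com \<Rightarrow> nat" where
  "code_length Skip = 0"
| "code_length (Ins x) = 1"
| "code_length (c1 ;; c2) = code_length c1 + code_length c2"
| "code_length (If_Less a b c1 c2) = code_length c1 + code_length c2 + 2"
| "code_length (While_Less a b c) = code_length c + 2"

text \<open>Since \<open>R 0 < R 0\<close> never holds, \<open>Jump_Unless_Less 0 0 l\<close> is an unconditional jump.\<close>

fun code :: "com \<Rightarrow> nat \<Rightarrow> instr list" where
  "code Skip i = []"
| "code (Ins x) i = [x]"
| "code (c1 ;; c2) i = code c1 i @ code c2 (i + code_length c1)"
| "code (If_Less a b c1 c2) i =
     Jump_Unless_Less a b (i + code_length c1 + 2) # code c1 (i + 1) @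
     Jump_Unless_Less 0 0 (i + code_length c1 + code_length c2 + 2) # code c2 (i + code_length c1 + 2)"
| "code (While_Less a b c) i =
     Jump_Unless_Less a b (i + code_length c + 2) # code c (i + 1) @ [Jump_Unless_Less 0 0 i]"

fun com_wf :: "nat \<Rightarrow> com \<Rightarrow> bool" where
  "com_wf K Skip \<longleftrightarrow> True"
| "com_wf K (Ins x) \<longleftrightarrow> instr_wf K 0 x"
| "com_wf K (c1 ;; c2) \<longleftrightarrow> com_wf K c1 \<and> com_wf K c2"
| "com_wf K (If_Less a b c1 c2) \<longleftrightarrow> com_wf K c1 \<and> com_wf K c2"
| "com_wf K (While_Less a b c) \<longleftrightarrow> com_wf K c"

lemma length_code [simp]: "length (code c i) = code_length c"
  by (induction c arbitrary: i) auto

lemma instr_wf_mono: "instr_wf K l x \<Longrightarrow> l \<le> l' \<Longrightarrow> instr_wf K l' x"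
  by (cases x) auto

lemma instr_wf_code:
  "com_wf K c \<Longrightarrow> i + code_length c \<le> l \<Longrightarrow> x \<in> set (code c i) \<Longrightarrow> instr_wf K l x"
proof (induction c arbitrary: i)
  case (Seq c1 c2)
  from Seq.IH(1)[of i] Seq.IH(2)[of "i + code_length c1"] Seq.prems show ?case by auto
next
  case (If_Less a b c1 c2)
  from If_Less.IH(1)[of "i + 1"] If_Less.IH(2)[of "i + code_length c1 + 2"] If_Less.prems
  show ?case by auto
next
  case (While_Less a b c)
  from While_Less.IH[of "i + 1"] While_Less.prems show ?case by auto
qed (auto intro: instr_wf_mono[OF _ le0])

definition code_at :: "instr list \<Rightarrow> nat \<Rightarrow> instr list \<Rightarrow> bool" where
  "code_at P i xs \<longleftrightarrow> (\<exists>ys zs. P = ys @ xs @ zs \<and> length ys = i)"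

lemma code_at_append: "code_at P i (xs @ xs') \<Longrightarrow> code_at P i xs \<and> code_at P (i + length xs) xs'"
  unfolding code_at_def by (metis append.assoc length_append)

lemma code_at_Cons: "code_at P i (x # xs) \<Longrightarrow> i < length P \<and> P ! i = x \<and> code_at P (Suc i) xs"
proof -
  assume "code_at P i (x # xs)"
  then obtain ys zs where P: "P = ys @ (x # xs) @ zs" "length ys = i"
    unfolding code_at_def by blast
  then have "P = (ys @ [x]) @ xs @ zs" "length (ys @ [x]) = Suc i" by simp_all
  then have "code_at P (Suc i) xs" unfolding code_at_def by blast
  then show ?thesis using P by auto
qed

section \<open>A total-correctness calculus that counts instructions\<close>

locale execution =
  fixes I :: graph_oracle and W :: nat
  assumes W: "1 \<le> W"
begin

text \<open>\<open>t\<close> counts instructions, each charged at the rate of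
  \<open>leads_instr\<close>. Quantifying over all programs that contain the code at some position
  makes the judgement independent of where a fragment is placed, so fragments compose.\<close>

definition ach :: "com \<Rightarrow> nat \<Rightarrow> store \<Rightarrow> (store \<Rightarrow> bool) \<Rightarrow> bool" where
  "ach c t S Q \<longleftrightarrow>
     (\<forall>K P i d. code_at P i (code c i) \<longrightarrow> represents W i S d \<longrightarrow>
        leads (instr_machine K P) I W (t * (2 * W + 2)) d
          (\<lambda>d'. \<exists>S'. Q S' \<and> represents W (i + code_length c) S' d'))"

lemma achI:
  assumes "\<And>K P i d. code_at P i (code c i) \<Longrightarrow> represents W i S d \<Longrightarrow>
        leads (instr_machine K P) I W (t * (2 * W + 2)) d
          (\<lambda>d'. \<exists>S'. Q S' \<and> represents W (i + code_length c) S' d')"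
  shows "ach c t S Q"
  using assms unfolding ach_def by blast

lemma achD:
  assumes "ach c t S Q" "code_at P i (code c i)" "represents W i S d"
  shows "leads (instr_machine K P) I W (t * (2 * W + 2)) d
          (\<lambda>d'. \<exists>S'. Q S' \<and> represents W (i + code_length c) S' d')"
  using assms unfolding ach_def by blast

lemma ach_mono:
  assumes "ach c t S Q" "t \<le> t'" "\<And>S'. Q S' \<Longrightarrow> Q' S'"
  shows "ach c t' S Q'"
proof (rule achI)
  fix K P i d
  assume "code_at P i (code c i)" "represents W i S d"
  from achD[OF assms(1) this, of K]
  show "leads (instr_machine K P) I W (t' * (2 * W + 2)) d
          (\<lambda>d'. \<exists>S'. Q' S' \<and> represents W (i + code_length c) S' d')"
    by (rule leads_mono, intro mult_le_mono1 assms(2), use assms(3) in blast)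
qed

lemma represents_pos: "represents W i S d \<Longrightarrow> \<forall>x. pos d x \<le> W"
  by (auto simp: represents_def conf_at_def)

lemma ach_skip: "Q S \<Longrightarrow> ach Skip 0 S Q"
  by (rule achI, rule leads_refl) (auto dest: represents_pos simp del: split_paired_Ex)

lemma ach_ins:
  assumes "enabled x S" "bounded W S \<Longrightarrow> bounded W (effect I x S)" "Q (effect I x S)"
    "\<forall>a b l. x \<noteq> Jump_Unless_Less a b l"
  shows "ach (Ins x) 1 S Q"
proof (rule achI)
  fix K P i d
  assume at: "code_at P i (code (Ins x) i)" and d: "represents W i S d"
  have "bounded W S" using d by (simp add: represents_def)
  moreover have "i < length P" "P ! i = x" using code_at_Cons[of P i x "[]"] at by auto
  ultimately have "leads (instr_machine K P) I W (2 * W + 2) d (represents W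
      (next_pc x i (case x of Jump_Unless_Less a b l \<Rightarrow> fst S a < fst S b | _ \<Rightarrow> False)) (effect I x S))"
    using assms d W by (intro leads_instr) auto
  then show "leads (instr_machine K P) I W (1 * (2 * W + 2)) d
          (\<lambda>d'. \<exists>S'. Q S' \<and> represents W (i + code_length (Ins x)) S' d')"
  proof (rule leads_mono)
    fix d
    assume "represents W (next_pc x i (case x of Jump_Unless_Less a b l \<Rightarrow> fst S a < fst S b | _ \<Rightarrow> False))
      (effect I x S) d"
    then have "represents W (i + code_length (Ins x)) (effect I x S) d"
      using assms(4) by (cases x) (auto simp del: split_paired_Ex)
    then show "\<exists>S'. Q S' \<and> represents W (i + code_length (Ins x)) S' d" using assms(3) by blast
  qed simp
qed

lemma leads_jump:
  assumes "i < length P" "P ! i = Jump_Unless_Less a b l" "represents W i S d"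
  shows "leads (instr_machine K P) I W (2 * W + 2) d
    (represents W (if fst S a < fst S b then Suc i else l) S)"
proof -
  have "bounded W S" using assms(3) by (simp add: represents_def)
  from leads_instr[OF assms W, of I K] this show ?thesis by simp
qed

lemma ach_seq:
  assumes "ach c1 t1 S (\<lambda>S'. ach c2 t2 S' Q)"
  shows "ach (c1 ;; c2) (t1 + t2) S Q"
proof (rule achI)
  fix K P i d
  assume at: "code_at P i (code (c1 ;; c2) i)" and d: "represents W i S d"
  have at1: "code_at P i (code c1 i)" and at2: "code_at P (i + code_length c1) (code c2 (i + code_length c1))"
    using code_at_append[of P i "code c1 i" "code c2 (i + code_length c1)"] at by auto
  have "leads (instr_machine K P) I W (t1 * (2 * W + 2) + t2 * (2 * W + 2)) d
          (\<lambda>d'. \<exists>S'. Q S' \<and> represents W (i + code_length (c1 ;; c2)) S' d')"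
  proof (rule leads_trans[OF achD[OF assms at1 d]])
    fix d'
    assume "\<exists>S'. ach c2 t2 S' Q \<and> represents W (i + code_length c1) S' d'"
    then obtain S' where "ach c2 t2 S' Q" "represents W (i + code_length c1) S' d'" by blast
    from achD[OF this(1) at2 this(2), of K]
    show "leads (instr_machine K P) I W (t2 * (2 * W + 2)) d'
          (\<lambda>d'. \<exists>S'. Q S' \<and> represents W (i + code_length (c1 ;; c2)) S' d')"
      by (simp add: add.assoc)
  qed
  then show "leads (instr_machine K P) I W ((t1 + t2) * (2 * W + 2)) d
          (\<lambda>d'. \<exists>S'. Q S' \<and> represents W (i + code_length (c1 ;; c2)) S' d')"
    by (simp only: distrib_right)
qed

lemma ach_if:
  assumes "fst S a < fst S b \<Longrightarrow> ach c1 t S Q" "\<not> fst S a < fst S b \<Longrightarrow> ach c2 t S Q"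
  shows "ach (If_Less a b c1 c2) (t + 2) S Q"
proof (rule achI)
  fix K P i d
  assume at: "code_at P i (code (If_Less a b c1 c2) i)" and d: "represents W i S d"
  let ?M = "instr_machine K P" and ?U = "2 * W + 2"
  let ?end = "i + code_length c1 + code_length c2 + 2"
  define xs where "xs = code c1 (i + 1)"
  define ys where "ys = code c2 (i + code_length c1 + 2)"
  from code_at_Cons[OF at[unfolded code.simps]]
  have 1: "i < length P" "P ! i = Jump_Unless_Less a b (i + code_length c1 + 2)"
    and at': "code_at P (i + 1) (xs @ (Jump_Unless_Less 0 0 ?end # ys))"
    by (simp_all add: xs_def ys_def)
  from code_at_append[OF at'] have at1: "code_at P (i + 1) xs"
    and at'': "code_at P (i + code_length c1 + 1) (Jump_Unless_Less 0 0 ?end # ys)"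
    by (simp_all add: xs_def add.commute)
  from code_at_Cons[OF at''] have 2: "i + code_length c1 + 1 < length P"
    "P ! (i + code_length c1 + 1) = Jump_Unless_Less 0 0 ?end"
    and at2: "code_at P (i + code_length c1 + 2) ys"
    by simp_all
  let ?G = "\<lambda>d'. \<exists>S'. Q S' \<and> represents W ?end S' d'"
  have "leads ?M I W (?U + (t * ?U + ?U)) d ?G"
  proof (rule leads_trans[OF leads_jump[OF 1 d]])
    fix d1
    assume d1: "represents W (if fst S a < fst S b then Suc i else i + code_length c1 + 2) S d1"
    show "leads ?M I W (t * ?U + ?U) d1 ?G"
    proof (cases "fst S a < fst S b")
      case True
      then have "represents W (i + 1) S d1" using d1 by simp
      from achD[OF assms(1)[OF True] at1[unfolded xs_def] this, of K]
      show ?thesis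
      proof (rule leads_trans)
        fix d2
        assume "\<exists>S'. Q S' \<and> represents W (i + 1 + code_length c1) S' d2"
        then obtain S' where S': "Q S'" "represents W (i + code_length c1 + 1) S' d2"
          by (auto simp: add.commute add.left_commute simp del: split_paired_Ex)
        from leads_jump[OF 2 S'(2), of K] show "leads ?M I W ?U d2 ?G"
          by (rule leads_mono) (use S'(1) in \<open>auto simp del: split_paired_Ex\<close>)
      qed
    next
      case False
      then have "represents W (i + code_length c1 + 2) S d1" using d1 by simp
      from achD[OF assms(2)[OF False] at2[unfolded ys_def] this, of K]
      show ?thesis by (rule leads_mono) (simp_all add: add.commute add.left_commute)
    qed
  qed
  then show "leads ?M I W ((t + 2) * ?U) d
      (\<lambda>d'. \<exists>S'. Q S' \<and> represents W (i + code_length (If_Less a b c1 c2)) S' d')"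
    by (rule leads_mono) (simp_all add: algebra_simps)
qed

lemma ach_while_exit:
  assumes "\<not> fst S a < fst S b" "Q S"
  shows "ach (While_Less a b c) 1 S Q"
proof (rule achI)
  fix K P i d
  assume at: "code_at P i (code (While_Less a b c) i)" and d: "represents W i S d"
  from code_at_Cons[OF at[unfolded code.simps]]
  have 1: "i < length P" "P ! i = Jump_Unless_Less a b (i + code_length c + 2)" by simp_all
  from leads_jump[OF 1 d, of K]
  show "leads (instr_machine K P) I W (1 * (2 * W + 2)) d
      (\<lambda>d'. \<exists>S'. Q S' \<and> represents W (i + code_length (While_Less a b c)) S' d')"
    by (rule leads_mono) (use assms in \<open>auto simp: add.assoc simp del: split_paired_Ex\<close>)
qed

lemma ach_while_iterate:
  assumes "fst S a < fst S b" "ach c t1 S (\<lambda>S'. ach (While_Less a b c) t2 S' Q)"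
  shows "ach (While_Less a b c) (t1 + 2 + t2) S Q"
proof (rule achI)
  fix K P i d
  assume at: "code_at P i (code (While_Less a b c) i)" and d: "represents W i S d"
  let ?M = "instr_machine K P" and ?U = "2 * W + 2"
  let ?G = "\<lambda>d'. \<exists>S'. Q S' \<and> represents W (i + code_length (While_Less a b c)) S' d'"
  define xs where "xs = code c (i + 1)"
  from code_at_Cons[OF at[unfolded code.simps]]
  have 1: "i < length P" "P ! i = Jump_Unless_Less a b (i + code_length c + 2)"
    and at': "code_at P (i + 1) (xs @ [Jump_Unless_Less 0 0 i])"
    by (simp_all add: xs_def)
  from code_at_append[OF at'] have at1: "code_at P (i + 1) xs"
    and at'': "code_at P (i + code_length c + 1) [Jump_Unless_Less 0 0 i]"
    by (simp_all add: xs_def add.commute)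
  from code_at_Cons[OF at''] have 2: "i + code_length c + 1 < length P"
    "P ! (i + code_length c + 1) = Jump_Unless_Less 0 0 i"
    by simp_all
  have "leads ?M I W (?U + (t1 * ?U + (?U + t2 * ?U))) d ?G"
  proof (rule leads_trans[OF leads_jump[OF 1 d]])
    fix d1
    assume "represents W (if fst S a < fst S b then Suc i else i + code_length c + 2) S d1"
    then have "represents W (i + 1) S d1" using assms(1) by simp
    from achD[OF assms(2) at1[unfolded xs_def] this, of K]
    show "leads ?M I W (t1 * ?U + (?U + t2 * ?U)) d1 ?G"
    proof (rule leads_trans)
      fix d2
      assume "\<exists>S'. ach (While_Less a b c) t2 S' Q \<and> represents W (i + 1 + code_length c) S' d2"
      then obtain S' where S': "ach (While_Less a b c) t2 S' Q" "represents W (i + code_length c + 1) S' d2"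
        by (auto simp: add.commute add.left_commute simp del: split_paired_Ex)
      from leads_jump[OF 2 S'(2), of K] show "leads ?M I W (?U + t2 * ?U) d2 ?G"
      proof (rule leads_trans)
        fix d3
        assume "represents W (if fst S' 0 < fst S' 0 then Suc (i + code_length c + 1) else i) S' d3"
        then have "represents W i S' d3" by simp
        from achD[OF S'(1) at this] show "leads ?M I W (t2 * ?U) d3 ?G" .
      qed
    qed
  qed
  then show "leads ?M I W ((t1 + 2 + t2) * ?U) d ?G"
    by (rule leads_mono) (simp_all add: algebra_simps)
qed

text \<open>The invariant is indexed by the number of completed iterations, which fixes their total
  as \<open>N\<close> and yields termination, time and result together. The cost may vary with the
  index, so that a loop over the vertices can charge each one its in-degree.\<close>

lemma ach_while:
  assumes "\<And>k S. k < N \<Longrightarrow> Inv k S \<Longrightarrow> fst S a < fst S b"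
    and "\<And>k S. k < N \<Longrightarrow> Inv k S \<Longrightarrow> ach c (t k) S (Inv (Suc k))"
    and "\<And>S. Inv N S \<Longrightarrow> \<not> fst S a < fst S b"
    and "Inv 0 S"
  shows "ach (While_Less a b c) ((\<Sum>k<N. t k + 2) + 1) S (Inv N)"
proof -
  have "ach (While_Less a b c) ((\<Sum>j\<in>{k..<N}. t j + 2) + 1) S (Inv N)" if "k \<le> N" "Inv k S" for k S
    using that
  proof (induction k arbitrary: S rule: inc_induct)
    case base
    then show ?case using ach_while_exit[OF assms(3)] by simp
  next
    case (step k)
    have "ach (While_Less a b c) (t k + 2 + ((\<Sum>j\<in>{Suc k..<N}. t j + 2) + 1)) S (Inv N)"
      by (rule ach_while_iterate[OF assms(1)[OF step(2,4)]], rule ach_mono[OF assms(2)[OF step(2,4)]])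
        (use step in auto)
    then show ?case using step(2) by (simp add: sum.atLeast_Suc_lessThan add.assoc)
  qed
  from this[OF _ assms(4)] show ?thesis by (simp add: atLeast0LessThan)
qed

end

section \<open>Symbolic execution of straight-line code\<close>

abbreviation "Copy a b \<equiv> Ins (Arith a False (Some b) False)"
abbreviation "Clear a \<equiv> Ins (Arith a False None False)"
abbreviation "One a \<equiv> Ins (Arith a False None True)"
abbreviation "Plus a b \<equiv> Ins (Arith a True (Some b) False)"
abbreviation "Incr a \<equiv> Ins (Arith a True None True)"
abbreviation "Less_To c a b \<equiv> If_Less a b (One c) (Clear c)"

context execution
begin

text \<open>The continuation form peels off the first instruction, so that a block closed by
  \<open>Skip\<close> is executed symbolically by applying such rules repeatedly.\<close>

lemma ach_ins_seq:
  assumes "enabled x S" "bounded W S \<Longrightarrow> bounded W (effect I x S)" "ach c t (effect I x S) Q"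
    "\<forall>a b l. x \<noteq> Jump_Unless_Less a b l"
  shows "ach (Ins x ;; c) (1 + t) S Q"
  by (rule ach_seq[OF ach_ins]) (use assms in auto)

lemma bounded_upd: "bounded W (R, m) \<Longrightarrow> v < 2 ^ W \<Longrightarrow> bounded W (R(a := v), m')"
  by (auto simp: bounded_def)

lemma bounded_reg: "bounded W (R, m) \<Longrightarrow> R r < 2 ^ W"
  by (auto simp: bounded_def)

lemma one_less: "1 < (2::nat) ^ W"
  using W by (intro one_less_power) auto

lemma ach_copy: "ach c t (R(a := R b), mem, out) Q \<Longrightarrow> ach (Copy a b ;; c) (1 + t) (R, mem, out) Q"
  by (rule ach_ins_seq) (auto simp del: fun_upd_apply intro!: bounded_upd elim: bounded_reg)

lemma ach_clear: "ach c t (R(a := 0), mem, out) Q \<Longrightarrow> ach (Clear a ;; c) (1 + t) (R, mem, out) Q"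
  by (rule ach_ins_seq) (auto simp del: fun_upd_apply intro!: bounded_upd)

lemma ach_one: "ach c t (R(a := 1), mem, out) Q \<Longrightarrow> ach (One a ;; c) (1 + t) (R, mem, out) Q"
  using one_less
  by (intro ach_ins_seq) (auto simp del: fun_upd_apply intro!: bounded_upd)

lemma ach_plus:
  "ach c t (R(a := R a + R b), mem, out) Q \<Longrightarrow> R a + R b < 2 ^ W \<Longrightarrow>
     ach (Plus a b ;; c) (1 + t) (R, mem, out) Q"
  by (rule ach_ins_seq) (auto simp del: fun_upd_apply intro!: bounded_upd)

lemma ach_incr:
  "ach c t (R(a := Suc (R a)), mem, out) Q \<Longrightarrow> Suc (R a) < 2 ^ W \<Longrightarrow>
     ach (Incr a ;; c) (1 + t) (R, mem, out) Q"
  by (rule ach_ins_seq) (auto simp del: fun_upd_apply intro!: bounded_upd)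

lemma ach_read:
  "ach c t (R(a := of_bool (mem ! R 0)), mem, out) Q \<Longrightarrow> R 0 < length mem \<Longrightarrow>
     ach (Ins (Read a) ;; c) (1 + t) (R, mem, out) Q"
  using one_less
  by (intro ach_ins_seq) (auto simp del: fun_upd_apply intro!: bounded_upd)

lemma ach_write:
  "ach c t (R, mem[R 0 := odd (R a)], out) Q \<Longrightarrow> R 0 < length mem \<Longrightarrow>
     ach (Ins (Write a) ;; c) (1 + t) (R, mem, out) Q"
  by (rule ach_ins_seq) (auto simp: bounded_def)

lemma ach_query:
  "ach c t (R(a := v), mem, out) Q \<Longrightarrow> answer_to I k (R 1) (R 2) = Some v \<Longrightarrow> v < 2 ^ W \<Longrightarrow>
     ach (Ins (Query k a) ;; c) (1 + t) (R, mem, out) Q"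
  by (intro ach_ins_seq) (auto simp del: fun_upd_apply intro!: bounded_upd)

lemma ach_out:
  "ach c t (R, mem, out @ [b]) Q \<Longrightarrow> ach (Ins (Out b) ;; c) (1 + t) (R, mem, out) Q"
  by (intro ach_ins_seq) (auto simp: bounded_def)

lemma ach_less:
  assumes "ach c t (R(d := of_bool (R a < R b)), mem, out) Q"
  shows "ach (Less_To d a b ;; c) (3 + t) (R, mem, out) Q"
proof -
  have "ach (Less_To d a b) (1 + 2) (R, mem, out) (\<lambda>S. S = (R(d := of_bool (R a < R b)), mem, out))"
    using one_less
    by (intro ach_if ach_ins) (auto simp del: fun_upd_apply intro!: bounded_upd)
  then have "ach (Less_To d a b) 3 (R, mem, out) (\<lambda>S'. ach c t S' Q)"
    by (rule ach_mono) (use assms in simp_all)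
  then show ?thesis by (rule ach_seq)
qed

lemma ach_time: "ach c t S Q \<Longrightarrow> t \<le> t' \<Longrightarrow> ach c t' S Q"
  by (rule ach_mono)

end

section \<open>The reachability program\<close>

abbreviation (input) "rIndex \<equiv> 0 :: nat"
abbreviation (input) "rVertex \<equiv> 1 :: nat"
abbreviation (input) "rPosition \<equiv> 2 :: nat"
abbreviation (input) "rOrder \<equiv> 3 :: nat"
abbreviation (input) "rStride \<equiv> 4 :: nat"
abbreviation (input) "rSource \<equiv> 5 :: nat"
abbreviation (input) "rTarget \<equiv> 6 :: nat"
abbreviation (input) "rLimit \<equiv> 7 :: nat"
abbreviation (input) "rOne \<equiv> 8 :: nat"
abbreviation (input) "rZero \<equiv> 9 :: nat"
abbreviation (input) "rX \<equiv> 10 :: nat"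
abbreviation (input) "rY \<equiv> 11 :: nat"
abbreviation (input) "rCarry \<equiv> 12 :: nat"
abbreviation (input) "rDest \<equiv> 13 :: nat"
abbreviation (input) "rSrc \<equiv> 14 :: nat"
abbreviation (input) "rDegree \<equiv> 15 :: nat"
abbreviation (input) "rRound \<equiv> 16 :: nat"
abbreviation (input) "rProbe \<equiv> 17 :: nat"
abbreviation (input) "rFirst \<equiv> 18 :: nat"
abbreviation (input) "rSecond \<equiv> 19 :: nat"
abbreviation (input) "rFound \<equiv> 20 :: nat"
abbreviation (input) "rSquare \<equiv> 21 :: nat"
abbreviation (input) "rPower \<equiv> 22 :: nat"
abbreviation (input) "rSucc \<equiv> 23 :: nat"

text \<open>One column of a ripple-carry addition or subtraction. The digits of
  \<open>x + y + c\<close> and \<open>x - y - c\<close> have the same parity, so the two differ only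
  in the carry: the sum exceeds 1, or \<open>x < y + c\<close>.\<close>

definition push_bit_com :: "bool \<Rightarrow> com" where
  "push_bit_com sub =
     Copy rIndex rSrc ;; Ins (Read rY) ;; Copy rIndex rDest ;; Ins (Read rX) ;; Plus rY rCarry ;;
     (let rest = Ins (Write rY) ;; Plus rDest rStride ;; Plus rSrc rStride ;; Skip
      in if sub then Less_To rCarry rX rY ;; Plus rY rX ;; rest
         else Plus rY rX ;; Less_To rCarry rOne rY ;; rest)"

text \<open>The destination address doubles as loop counter: starting below \<open>2 * n\<close> and
  moving in steps of \<open>2 * n\<close>, it stays below the limit for exactly \<open>B\<close>
  columns. The carry out of the last column is dropped, which makes the arithmetic modular.\<close>

definition push_com :: "bool \<Rightarrow> com" where
  "push_com sub = Clear rCarry ;; While_Less rDest rLimit (push_bit_com sub)"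

text \<open>\<open>od\<close> and \<open>os\<close> name registers that hold 0 or \<open>n\<close>;
  they decide which family is changed and which is read, so the same code serves both half
  rounds.\<close>

definition arc_com :: "nat \<Rightarrow> nat \<Rightarrow> bool \<Rightarrow> com" where
  "arc_com od os sub =
     Copy rDest rVertex ;; Plus rDest od ;; Ins (Query In_Neighbor rSrc) ;; Plus rSrc os ;;
     push_com sub ;; Incr rPosition ;; Skip"

definition vertex_com :: "nat \<Rightarrow> nat \<Rightarrow> bool \<Rightarrow> com" where
  "vertex_com od os sub =
     Ins (Query In_Degree rDegree) ;; Clear rPosition ;;
     While_Less rPosition rDegree (arc_com od os sub) ;; Incr rVertex ;; Skip"

definition half_com :: "nat \<Rightarrow> nat \<Rightarrow> bool \<Rightarrow> com" where
  "half_com od os sub = Clear rVertex ;; While_Less rVertex rOrder (vertex_com od os sub)"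

definition forward_com :: com where
  "forward_com = Clear rRound ;; While_Less rRound rOrder
     (half_com rOrder rZero False ;; half_com rZero rOrder False ;; Incr rRound ;; Skip)"

definition backward_com :: com where
  "backward_com = Clear rRound ;; While_Less rRound rOrder
     (half_com rZero rOrder True ;; half_com rOrder rZero True ;; Incr rRound ;; Skip)"

text \<open>Bit 0 of register \<open>s\<close> has index \<open>s\<close>, so the vertex number is
  its address. Incrementing the bit and writing back the parity flips it.\<close>

definition probe_com :: "nat \<Rightarrow> com" where
  "probe_com r =
     forward_com ;; Copy rIndex rProbe ;; Ins (Read r) ;; backward_com ;;
     Copy rIndex rSource ;; Ins (Read rX) ;; Incr rX ;; Ins (Write rX) ;; Skip"

definition compare_com :: com where
  "compare_com =
     probe_com rFirst ;; probe_com rSecond ;;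
     Less_To rX rFirst rSecond ;; Plus rFound rX ;; Less_To rX rSecond rFirst ;; Plus rFound rX ;;
     Plus rProbe rOrder ;; Skip"

definition setup_com :: com where
  "setup_com =
     Ins (Query Order rOrder) ;; Ins (Query Source rSource) ;; Ins (Query Target rTarget) ;;
     Copy rStride rOrder ;; Plus rStride rOrder ;; One rOne ;;
     Copy rSucc rOrder ;; Incr rSucc ;;
     While_Less rVertex rOrder (Plus rSquare rStride ;; Plus rSquare rStride ;; Incr rVertex ;; Skip) ;;
     Copy rLimit rSquare ;; One rPower ;;
     While_Less rPower rSucc (Plus rPower rPower ;; Plus rLimit rSquare ;; Skip)"

definition main_com :: com where
  "main_com =
     setup_com ;; Copy rProbe rTarget ;; While_Less rProbe rLimit compare_com ;;
     If_Less rZero rFound (Ins (Out True)) (Ins (Out False))"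

text \<open>Registers 0 to 23 and the two marker tracks make 26 tracks.\<close>

lemma main_com_wf: "com_wf 26 main_com"
  by (simp add: main_com_def setup_com_def compare_com_def probe_com_def backward_com_def
      forward_com_def half_com_def vertex_com_def arc_com_def push_com_def push_bit_com_def Let_def)

section \<open>Frame conditions and the precision of the tape registers\<close>

definition same_except :: "nat set \<Rightarrow> (nat \<Rightarrow> nat) \<Rightarrow> (nat \<Rightarrow> nat) \<Rightarrow> bool" where
  "same_except A R R' \<longleftrightarrow> (\<forall>r. r \<notin> A \<longrightarrow> R' r = R r)"

lemma same_exceptD: "same_except A R R' \<Longrightarrow> r \<notin> A \<Longrightarrow> R' r = R r"
  by (simp add: same_except_def)

lemma same_except_refl [simp]: "same_except A R R"
  by (simp add: same_except_def)

lemma same_except_upd [simp]: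
  "a \<in> A \<Longrightarrow> same_except A R R' \<Longrightarrow> same_except A R (R'(a := v))"
  by (simp add: same_except_def)

lemma same_except_trans:
  "same_except A R R' \<Longrightarrow> same_except B R' R'' \<Longrightarrow> A \<union> B \<subseteq> C \<Longrightarrow> same_except C R R''"
  unfolding same_except_def by (metis UnI1 UnI2 subsetD)

text \<open>There are \<open>2 * n\<close> half rounds, each multiplying the counts by at most
  \<open>n + 1\<close>, and \<open>n + 1\<close> is at most \<open>2 ^ floorlog 2 n\<close>. The
  added 1 makes the resulting bound on the counts strict.\<close>

definition precision :: "nat \<Rightarrow> nat" where
  "precision n = 2 * n * (floorlog 2 n + 1)"

text \<open>
  Bit \<open>b\<close> of register \<open>r\<close> lies at index \<open>r + 2 * n * b\<close> of the catalytic tape, so that an addition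
  walks through both operands in steps of \<open>2 * n\<close> and needs no multiplication. Registers \<open>v\<close> and
  \<open>v + n\<close> belong to vertex \<open>v\<close>.
\<close>

locale path_counting = execution +
  fixes n s t :: nat
  assumes order: "order_of I = n" and source: "source_of I = s" and target: "target_of I = t"
    and s_less: "s < n" and t_less: "t < n"
    and in_nbrs_less: "\<And>u v. v < n \<Longrightarrow> u \<in> set (in_nbrs I v) \<Longrightarrow> u < n"
    and in_degree_le: "\<And>v. v < n \<Longrightarrow> length (in_nbrs I v) \<le> n"
    and room: "4 * (2 * n * precision n) + 4 < 2 ^ W"
begin

abbreviation B where "B \<equiv> precision n"
abbreviation limit where "limit \<equiv> 2 * n * B"

definition num_arcs :: nat where
  "num_arcs = (\<Sum>v<n. length (in_nbrs I v))"

lemma n_pos: "0 < n" using s_less by simp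

lemma n_le_limit: "n \<le> limit" "n * n \<le> limit"
  using n_pos by (auto simp: precision_def)

definition fixed_regs :: "(nat \<Rightarrow> nat) \<Rightarrow> bool" where
  "fixed_regs R \<longleftrightarrow> R rOrder = n \<and> R rStride = 2 * n \<and> R rSource = s \<and> R rTarget = t \<and>
     R rLimit = limit \<and> R rOne = 1 \<and> R rZero = 0"

lemma fixed_regs_same:
  assumes "fixed_regs R" "same_except A R R'" "A \<inter> {3, 4, 5, 6, 7, 8, 9} = {}"
  shows "fixed_regs R'"
proof -
  have "R' r = R r" if "r \<in> {3, 4, 5, 6, 7, 8, 9}" for r
    using assms(2,3) that unfolding same_except_def by blast
  then show ?thesis using assms(1) by (simp add: fixed_regs_def)
qed

section \<open>Layout of integers on the catalytic tape\<close>

definition holds_bits :: "(nat \<Rightarrow> nat \<Rightarrow> bool) \<Rightarrow> bool list \<Rightarrow> bool" where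
  "holds_bits f mem \<longleftrightarrow> length mem = limit \<and> (\<forall>r<2 * n. \<forall>b<B. mem ! (r + 2 * n * b) = f r b)"

text \<open>The tape fixes \<open>V\<close> only modulo \<open>2 ^ B\<close>. Using unbounded
  integers in two's complement makes every operation on \<open>V\<close> exact, so linearity and
  inverses are plain integer algebra without any modulus. The version with arbitrary digits
  describes a tape in the middle of an addition.\<close>

abbreviation holds :: "(nat \<Rightarrow> int) \<Rightarrow> bool list \<Rightarrow> bool" where
  "holds V \<equiv> holds_bits (\<lambda>r. bit (V r))"

lemma index_less:
  assumes "r < 2 * n" "b < B" shows "r + 2 * n * b < limit"
proof -
  have "r + 2 * n * b < 2 * n * Suc b" using assms by simp
  also have "\<dots> \<le> limit" using assms(2) by (intro mult_le_mono2) simp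
  finally show ?thesis .
qed

lemma index_inj:
  assumes "r < 2 * n" "r' < 2 * n"
  shows "r + 2 * n * b = r' + 2 * n * b' \<longleftrightarrow> r = r' \<and> b = b'"
proof
  assume eq: "r + 2 * n * b = r' + 2 * n * b'"
  have "(r + 2 * n * b) mod (2 * n) = r" "(r' + 2 * n * b') mod (2 * n) = r'"
    "(r + 2 * n * b) div (2 * n) = b" "(r' + 2 * n * b') div (2 * n) = b'"
    using assms by simp_all
  then show "r = r' \<and> b = b'" using eq by metis
qed simp

lemma holds_bits_nth:
  "holds_bits f mem \<Longrightarrow> r < 2 * n \<Longrightarrow> b < B \<Longrightarrow> mem ! (r + 2 * n * b) = f r b"
  by (simp add: holds_bits_def)

lemma holds_bits_update:
  assumes "holds_bits f mem" "d < 2 * n" "k < B"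
  shows "holds_bits (\<lambda>r b. if r = d \<and> b = k then v else f r b) (mem[d + 2 * n * k := v])"
  using assms index_less[OF assms(2,3)] unfolding holds_bits_def
  by (auto simp: nth_list_update index_inj)

text \<open>This yields exact restoration: a tape that again holds the initial integers is the
  initial tape, bit by bit.\<close>

lemma holds_bits_unique:
  assumes "holds_bits f mem" "holds_bits f mem'"
  shows "mem = mem'"
proof (rule nth_equalityI)
  show "length mem = length mem'" using assms by (simp add: holds_bits_def)
  fix i
  assume "i < length mem"
  then have "i < 2 * n * B" using assms by (simp add: holds_bits_def)
  then have "i mod (2 * n) < 2 * n" "i div (2 * n) < B"
    using n_pos by (auto simp: less_mult_imp_div_less mult.commute)
  moreover have "i = i mod (2 * n) + 2 * n * (i div (2 * n))" by simp
  ultimately show "mem ! i = mem' ! i" using assms by (metis holds_bits_nth)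
qed

section \<open>Adding or subtracting one tape register\<close>

definition sgn_of :: "bool \<Rightarrow> int" where
  "sgn_of sub = (if sub then -1 else 1)"

abbreviation "push_regs \<equiv> {rIndex, rX, rY, rCarry, rDest, rSrc}"

lemmas straight_line = ach_copy ach_clear ach_one ach_plus ach_incr ach_read ach_write ach_query
  ach_out ach_less ach_skip

text \<open>With \<open>d \<noteq> e\<close> the source keeps its digits while the destination is
  overwritten column by column. A column is charged 14 instructions and 2 for the loop.\<close>

lemma ach_push:
  assumes R: "fixed_regs R" "R rDest = d" "R rSrc = e" and de: "d < 2 * n" "e < 2 * n" "d \<noteq> e"
    and V: "holds V mem"
  shows "ach (push_com sub) (16 * B + 2) (R, mem, out) (\<lambda>(R', mem', out').
    out' = out \<and> holds (V(d := V d + sgn_of sub * V e)) mem' \<and> same_except push_regs R R')"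
proof -
  define cy where "cy = (if sub then borrow (V d) (V e) else carry False (V d) (V e))"
  define z where "z = V d + sgn_of sub * V e"
  \<comment> \<open>In between, the destination consists of the low \<open>k\<close> digits of the
    result and its old digits above them.\<close>
  define f where "f k = (\<lambda>r b. bit (if r = d \<and> b < k then z else V r) b)" for k
  define Inv where "Inv = (\<lambda>k (R', mem', out'). out' = out \<and> same_except push_regs R R' \<and>
    R' rDest = d + 2 * n * k \<and> R' rSrc = e + 2 * n * k \<and> R' rCarry = of_bool (cy k) \<and>
    holds_bits (f k) mem')"
  have bit_z: "bit z k \<longleftrightarrow> (bit (V d) k \<noteq> (bit (V e) k \<noteq> cy k))" for k
    using bit_add_carry[of "V d" "V e" False k] bit_diff_borrow[of "V d" "V e" k]
    by (simp add: z_def cy_def sgn_of_def)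
  have body: "ach (push_bit_com sub) 14 S (Inv (Suc k))" if k: "k < B" and inv: "Inv k S" for k S
  proof -
    obtain R' mem' where S: "S = (R', mem', out)" and same: "same_except push_regs R R'"
      and R': "R' rDest = d + 2 * n * k" "R' rSrc = e + 2 * n * k" "R' rCarry = of_bool (cy k)"
      and mem': "holds_bits (f k) mem'"
      using inv by (cases S) (auto simp: Inv_def)
    have cs: "R' rStride = 2 * n" "R' rOne = 1"
      using fixed_regs_same[OF R(1) same] by (simp_all add: fixed_regs_def)
    have len: "length mem' = limit" using mem' by (simp add: holds_bits_def)
    have idx: "d + 2 * n * k < limit" "e + 2 * n * k < limit"
      using index_less[OF _ k] de by auto
    define x y c where "x = (of_bool (bit (V d) k) :: nat)" and "y = (of_bool (bit (V e) k) :: nat)"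
      and "c = (of_bool (cy k) :: nat)"
    have rd: "of_bool (mem' ! (d + 2 * n * k)) = x" "of_bool (mem' ! (e + 2 * n * k)) = y"
      "R' rCarry = c"
      using holds_bits_nth[OF mem' _ k] de R'(3) by (auto simp: f_def x_def y_def c_def)
    have small: "x \<le> 1" "y \<le> 1" "c \<le> 1" by (simp_all add: x_def y_def c_def)
    \<comment> \<open>The left side is the parity of \<open>y + c + x\<close>, spelled out with
      boolean equalities.\<close>
    have odd: "((even y = even c) = odd x) = bit z k" by (auto simp: bit_z x_def y_def c_def)
    have new: "holds_bits (f (Suc k)) (mem'[d + 2 * n * k := bit z k])"
    proof -
      have "(\<lambda>r b. if r = d \<and> b = k then bit z k else f k r b) = f (Suc k)"
        by (auto simp: f_def fun_eq_iff less_Suc_eq)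
      then show ?thesis using holds_bits_update[OF mem' de(1) k, of "bit z k"] by simp
    qed
    have roomy: "2 * (2 * n * B) + 3 < 2 ^ W" "3 < (2 :: nat) ^ W" "2 * n \<le> limit"
      using room n_pos by (auto simp: precision_def)
    \<comment> \<open>The last iteration moves both addresses past the limit, so the registers need
      room for one more stride.\<close>
    then have next_less: "d + 2 * n * k + 2 * n < 2 ^ W" "e + 2 * n * k + 2 * n < 2 ^ W"
      using idx by linarith+
    show ?thesis
    proof (cases sub)
      case True
      have cyS: "x < y + c \<longleftrightarrow> cy (Suc k)"
        using True by (auto simp: x_def y_def c_def cy_def borrow_Suc)
      show ?thesis
        unfolding push_bit_com_def S Let_def if_P[OF True]
        apply (rule ach_time)
         apply (rule straight_line)+
                using idx roomy small
                apply (simp_all add: Inv_def R'(1,2) cs len rd cyS odd new same next_less)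
        done
    next
      case False
      have cyS: "Suc 0 < y + c + x \<longleftrightarrow> cy (Suc k)"
        using False by (auto simp: x_def y_def c_def cy_def carry_Suc)
      show ?thesis
        unfolding push_bit_com_def S Let_def if_not_P[OF False]
        apply (rule ach_time)
         apply (rule straight_line)+
                using idx roomy small
                apply (simp_all add: Inv_def R'(1,2) cs len rd cyS odd new same next_less)
        done
    qed
  qed
  have "ach (While_Less rDest rLimit (push_bit_com sub)) ((\<Sum>k<B. 14 + 2) + 1)
      (R(rCarry := 0), mem, out) (Inv B)"
  proof (rule ach_while[of B Inv])
    fix k S
    assume k: "k < B" and "Inv k S"
    then show "fst S rDest < fst S rLimit"
      using index_less[OF de(1) k] fixed_regs_same[OF R(1), of push_regs "fst S"]
      by (auto simp: Inv_def fixed_regs_def)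
    show "ach (push_bit_com sub) 14 S (Inv (Suc k))" by (rule body) fact+
  next
    fix S
    assume "Inv B S"
    then show "\<not> fst S rDest < fst S rLimit"
      using fixed_regs_same[OF R(1), of push_regs "fst S"]
      by (auto simp: Inv_def fixed_regs_def)
  next
    have "f 0 = (\<lambda>r. bit (V r))" by (simp add: f_def fun_eq_iff)
    then show "Inv 0 (R(rCarry := 0), mem, out)" using R V by (simp add: Inv_def cy_def)
  qed
  from ach_clear[OF this] show ?thesis
    unfolding push_com_def
  proof (rule ach_mono)
    fix S
    assume "Inv B S"
    \<comment> \<open>Only digits below \<open>B\<close> are on the tape, so the discarded last
      carry makes no difference.\<close>
    moreover have "holds_bits (f B) mem' = holds (V(d := z)) mem'" for mem'
      by (auto simp: holds_bits_def f_def)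
    ultimately show "case S of (R', mem', out') \<Rightarrow> out' = out \<and>
        holds (V(d := V d + sgn_of sub * V e)) mem' \<and> same_except push_regs R R'"
      by (auto simp: Inv_def z_def)
  qed simp
qed


section \<open>Half rounds as shears between the two families\<close>

definition half_map :: "int \<Rightarrow> nat \<Rightarrow> nat \<Rightarrow> (nat \<Rightarrow> int) \<Rightarrow> nat \<Rightarrow> int" where
  "half_map c p q V =
     (\<lambda>r. if p \<le> r \<and> r < p + n then V r + c * (\<Sum>u\<leftarrow>in_nbrs I (r - p). V (u + q)) else V r)"

definition offsets :: "nat \<Rightarrow> nat \<Rightarrow> nat \<Rightarrow> nat \<Rightarrow> bool" where
  "offsets od os p q \<longleftrightarrow>
     od = rOrder \<and> os = rZero \<and> p = n \<and> q = 0 \<or> od = rZero \<and> os = rOrder \<and> p = 0 \<and> q = n"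

abbreviation "arc_regs \<equiv> insert rPosition push_regs"
abbreviation "vertex_regs \<equiv> {rVertex, rDegree} \<union> arc_regs"

lemma small_values: "4 * n + 3 < 2 ^ W"
  using room n_le_limit by linarith

lemma ach_arc:
  assumes R: "fixed_regs R" "R rVertex = v" "R rPosition = i" and v: "v < n"
    and i: "i < length (in_nbrs I v)" and off: "offsets od os p q" and V: "holds V mem"
  shows "ach (arc_com od os sub) (16 * B + 7) (R, mem, out) (\<lambda>(R', mem', out').
    out' = out \<and> holds (V(v + p := V (v + p) + sgn_of sub * V (in_nbrs I v ! i + q))) mem' \<and>
    same_except arc_regs R R' \<and> R' rPosition = Suc i)" (is "ach _ _ _ ?Q")
proof -
  define u where "u = in_nbrs I v ! i"
  have u: "u < n" using in_nbrs_less[OF v, of u] i by (simp add: u_def)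
  have ans: "answer_to I In_Neighbor v i = Some u"
    using v i by (simp add: order u_def)
  \<comment> \<open>The two registers belong to different families, so they are distinct even for a
    loop arc.\<close>
  have di: "v + p < 2 * n" "u + q < 2 * n" "v + p \<noteq> u + q" using off u v by (auto simp: offsets_def)
  have i_less: "Suc i < 2 ^ W" using i in_degree_le[OF v] small_values by linarith
  have tail: "ach (push_com sub ;; Incr rPosition ;; Skip) (16 * B + 2 + (1 + 0)) (R1, mem, out) ?Q"
    if R1: "R1 rDest = v + p" "R1 rSrc = u + q" "same_except push_regs R R1" for R1
  proof (rule ach_seq, rule ach_mono[OF ach_push[OF _ R1(1,2) di V]])
    show "fixed_regs R1" using fixed_regs_same[OF R(1) R1(3)] by simp
    fix S
    assume S: "case S of (R', mem', out') \<Rightarrow> out' = out \<and>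
      holds (V(v + p := V (v + p) + sgn_of sub * V (u + q))) mem' \<and> same_except push_regs R1 R'"
    then obtain R' mem' where S: "S = (R', mem', out)" "same_except push_regs R1 R'"
      "holds (V(v + p := V (v + p) + sgn_of sub * V (u + q))) mem'" by (cases S) auto
    have same: "same_except push_regs R R'"
      using R1(3) S(2) by (rule same_except_trans) simp
    then have "R' rPosition = i" using R(3) same_exceptD by fastforce
    moreover have "same_except arc_regs R R'" using same by (auto simp: same_except_def)
    ultimately show "ach (Incr rPosition ;; Skip) (1 + 0) S ?Q"
      unfolding S(1) using i_less S(3)
      by (intro straight_line) (simp_all add: u_def)
  qed simp
  have c: "R rOrder = n" "R rZero = 0" using R(1) by (simp_all add: fixed_regs_def)
  have "v + p < 2 ^ W" "u < 2 ^ W" "u + q < 2 ^ W" using di v u small_values by linarith+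
  then show ?thesis
    unfolding arc_com_def using off R(2,3) c ans[simplified]
    apply -
    apply (rule ach_time)
     apply (rule ach_query[where v = u] straight_line)+
        apply (rule tail)
    by (auto simp: offsets_def)
qed

lemma ach_vertex:
  assumes R: "fixed_regs R" "R rVertex = v" and v: "v < n" and off: "offsets od os p q"
    and V: "holds V mem"
  shows "ach (vertex_com od os sub) (length (in_nbrs I v) * (16 * B + 9) + 4) (R, mem, out)
    (\<lambda>(R', mem', out'). out' = out \<and>
      holds (V(v + p := V (v + p) + sgn_of sub * (\<Sum>u\<leftarrow>in_nbrs I v. V (u + q)))) mem' \<and>
      same_except vertex_regs R R' \<and> R' rVertex = Suc v)" (is "ach _ _ _ ?Q")
proof -
  let ?l = "length (in_nbrs I v)"
  define U where "U i = V(v + p := V (v + p) + sgn_of sub * (\<Sum>u\<leftarrow>take i (in_nbrs I v). V (u + q)))" for i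
  have U0: "U 0 = V" by (simp add: U_def)
  define Inv where "Inv = (\<lambda>i (R', mem', out'). out' = out \<and> holds (U i) mem' \<and>
    same_except vertex_regs R R' \<and> R' rVertex = v \<and> R' rPosition = i \<and> R' rDegree = ?l)"
  have body: "ach (arc_com od os sub) (16 * B + 7) S (Inv (Suc i))" if i: "i < ?l" and inv: "Inv i S" for i S
  proof -
    obtain R' mem' where S: "S = (R', mem', out)" and U: "holds (U i) mem'"
      and same: "same_except vertex_regs R R'"
      and R': "R' rVertex = v" "R' rPosition = i" "R' rDegree = ?l"
      using inv by (cases S) (auto simp: Inv_def)
    have "in_nbrs I v ! i < n" using in_nbrs_less[OF v] i by simp
    then have "in_nbrs I v ! i + q \<noteq> v + p" using off v by (auto simp: offsets_def)
    then have step: "(U i)(v + p := U i (v + p) + sgn_of sub * U i (in_nbrs I v ! i + q)) = U (Suc i)"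
      using i by (auto simp: U_def fun_eq_iff take_Suc_conv_app_nth algebra_simps)
    have "fixed_regs R'" using fixed_regs_same[OF R(1) same] by simp
    from ach_arc[OF this R'(1,2) v i off U, of sub out] show ?thesis
      unfolding S step
    proof (rule ach_mono)
      fix S'
      assume "case S' of (R'', mem'', out'') \<Rightarrow> out'' = out \<and> holds (U (Suc i)) mem'' \<and>
        same_except arc_regs R' R'' \<and> R'' rPosition = Suc i"
      then show "Inv (Suc i) S'"
        using same_except_trans[OF same, of arc_regs "fst S'" vertex_regs] R'
          same_exceptD[of arc_regs R' "fst S'" rVertex] same_exceptD[of arc_regs R' "fst S'" rDegree]
        by (auto simp: Inv_def)
    qed simp
  qed
  have loop: "ach (While_Less rPosition rDegree (arc_com od os sub)) ((\<Sum>i<?l. 16 * B + 7 + 2) + 1)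
      (R(rDegree := ?l, rPosition := 0), mem, out) (Inv ?l)"
  proof (rule ach_while[of ?l Inv, OF _ body])
    show "Inv 0 (R(rDegree := ?l, rPosition := 0), mem, out)"
      using R V U0 by (simp add: Inv_def)
  qed (auto simp: Inv_def)
  have tail: "ach (Incr rVertex ;; Skip) (1 + 0) S ?Q" if inv: "Inv ?l S" for S
  proof -
    obtain R' mem' where S: "S = (R', mem', out)" and U: "holds (U ?l) mem'"
      "same_except vertex_regs R R'" "R' rVertex = v"
      using inv by (cases S) (auto simp: Inv_def)
    from U show ?thesis
      unfolding S using v small_values by (intro ach_incr ach_skip) (simp_all add: U_def)
  qed
  have deg: "answer_to I In_Degree (R 1) (R 2) = Some ?l" using v R(2) by (simp add: order)
  have "?l < 2 ^ W" using in_degree_le[OF v] small_values by linarith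
  moreover have "ach (While_Less rPosition rDegree (arc_com od os sub) ;; Incr rVertex ;; Skip)
      ((\<Sum>i<?l. 16 * B + 7 + 2) + 1 + (1 + 0)) (R(rDegree := ?l, rPosition := 0), mem, out) ?Q"
    by (rule ach_seq, rule ach_mono[OF loop order.refl tail])
  ultimately have "ach (vertex_com od os sub) (1 + (1 + ((\<Sum>i<?l. 16 * B + 7 + 2) + 1 + (1 + 0)))) (R, mem, out) ?Q"
    unfolding vertex_com_def using deg by (intro ach_query ach_clear)
  then show ?thesis by (rule ach_time) simp
qed

lemma ach_half:
  assumes R: "fixed_regs R" and off: "offsets od os p q" and V: "holds V mem"
  shows "ach (half_com od os sub) (num_arcs * (16 * B + 9) + 6 * n + 2) (R, mem, out)
    (\<lambda>(R', mem', out'). out' = out \<and> holds (half_map (sgn_of sub) p q V) mem' \<and>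
      same_except vertex_regs R R')"
proof -
  define U where "U v = (\<lambda>r. if p \<le> r \<and> r < p + v
    then V r + sgn_of sub * (\<Sum>u\<leftarrow>in_nbrs I (r - p). V (u + q)) else V r)" for v
  have U0: "U 0 = V" by (simp add: U_def fun_eq_iff)
  define Inv where "Inv = (\<lambda>v (R', mem', out'). out' = out \<and> holds (U v) mem' \<and>
    same_except vertex_regs R R' \<and> R' rVertex = v)"
  have body: "ach (vertex_com od os sub) (length (in_nbrs I v) * (16 * B + 9) + 4) S (Inv (Suc v))"
    if v: "v < n" and inv: "Inv v S" for v S
  proof -
    obtain R' mem' where S: "S = (R', mem', out)" and U: "holds (U v) mem'"
      and same: "same_except vertex_regs R R'" and R': "R' rVertex = v"
      using inv by (cases S) (auto simp: Inv_def)
    \<comment> \<open>Only the destination family has changed so far, so the sums still see the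
      original source values.\<close>
    have "U v (u + q) = V (u + q)" if "u < n" for u
      using that v off by (auto simp: U_def offsets_def)
    then have "(\<Sum>u\<leftarrow>in_nbrs I v. U v (u + q)) = (\<Sum>u\<leftarrow>in_nbrs I v. V (u + q))"
      using in_nbrs_less[OF v] by (intro arg_cong[of _ _ sum_list] map_cong) auto
    then have step: "(U v)(v + p := U v (v + p) + sgn_of sub * (\<Sum>u\<leftarrow>in_nbrs I v. U v (u + q))) = U (Suc v)"
      by (auto simp: U_def fun_eq_iff add.commute less_Suc_eq)
    have "fixed_regs R'" using fixed_regs_same[OF R same] by simp
    from ach_vertex[OF this R' v off U, of sub out] show ?thesis
      unfolding S step
    proof (rule ach_mono)
      fix S'
      assume "case S' of (R'', mem'', out'') \<Rightarrow> out'' = out \<and> holds (U (Suc v)) mem'' \<and>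
        same_except vertex_regs R' R'' \<and> R'' rVertex = Suc v"
      then show "Inv (Suc v) S'"
        using same_except_trans[OF same, of vertex_regs "fst S'" vertex_regs] by (auto simp: Inv_def)
    qed simp
  qed
  have bound: "fst S rOrder = n" if "Inv v S" for v S
    using that fixed_regs_same[OF R, of vertex_regs "fst S"] by (auto simp: Inv_def fixed_regs_def)
  have "ach (While_Less rVertex rOrder (vertex_com od os sub))
      ((\<Sum>v<n. length (in_nbrs I v) * (16 * B + 9) + 4 + 2) + 1) (R(rVertex := 0), mem, out) (Inv n)"
  proof (rule ach_while[of n Inv, OF _ body])
    show "Inv 0 (R(rVertex := 0), mem, out)"
      using V U0 by (simp add: Inv_def)
  qed (use bound in \<open>auto simp: Inv_def\<close>)
  from ach_clear[OF this] show ?thesis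
    unfolding half_com_def
  proof (rule ach_mono)
    show "1 + ((\<Sum>v<n. length (in_nbrs I v) * (16 * B + 9) + 4 + 2) + 1) \<le> num_arcs * (16 * B + 9) + 6 * n + 2"
      by (simp add: num_arcs_def sum.distrib sum_distrib_right)
    have "U n = half_map (sgn_of sub) p q V" by (simp add: U_def half_map_def)
    then show "case S of (R', mem', out') \<Rightarrow> out' = out \<and> holds (half_map (sgn_of sub) p q V) mem' \<and>
      same_except vertex_regs R R'" if "Inv n S" for S
      using that by (auto simp: Inv_def)
  qed
qed


section \<open>Rounds, their inverses and the perturbation\<close>

definition round_map :: "int \<Rightarrow> nat \<Rightarrow> nat \<Rightarrow> (nat \<Rightarrow> int) \<Rightarrow> nat \<Rightarrow> int" where
  "round_map c p q = half_map c q p \<circ> half_map c p q"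

abbreviation "forward \<equiv> round_map 1 n 0 ^^ n"
abbreviation "backward \<equiv> round_map (-1) 0 n ^^ n"

text \<open>Flipping the lowest bit adds 1 to an even number and subtracts 1 from an odd one. Up to
  sign this is a unit perturbation, but it touches a single bit of the tape and is its own
  inverse.\<close>

definition flip :: "(nat \<Rightarrow> int) \<Rightarrow> nat \<Rightarrow> int" where
  "flip V = V(s := flip_bit 0 (V s))"

definition half_time :: nat where
  "half_time = num_arcs * (16 * B + 9) + 6 * n + 2"

definition run_time :: nat where
  "run_time = n * (2 * half_time + 3) + 2"

lemma offsets_sym: "offsets od os p q \<Longrightarrow> offsets os od q p"
  by (auto simp: offsets_def)

lemma half_map_inverse:
  assumes "offsets od os p q"
  shows "half_map (- c) p q (half_map c p q V) = V"
proof
  fix r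
  have "(\<Sum>u\<leftarrow>in_nbrs I (r - p). half_map c p q V (u + q)) = (\<Sum>u\<leftarrow>in_nbrs I (r - p). V (u + q))"
    if "p \<le> r" "r < p + n"
  proof -
    have "half_map c p q V (u + q) = V (u + q)" if "u \<in> set (in_nbrs I (r - p))" for u
    proof -
      have "r - p < n" using \<open>p \<le> r\<close> \<open>r < p + n\<close> by linarith
      from in_nbrs_less[OF this that] assms show ?thesis by (auto simp: half_map_def offsets_def)
    qed
    then show ?thesis by (intro arg_cong[of _ _ sum_list] map_cong) auto
  qed
  then show "half_map (- c) p q (half_map c p q V) r = V r"
    by (simp add: half_map_def[of "- c"]) (simp add: half_map_def)
qed

lemma backward_forward: "backward (forward V) = V"
proof -
  have inv: "round_map (-1) 0 n (round_map 1 n 0 V) = V" for V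
    using half_map_inverse[of rOrder rZero n 0 1] half_map_inverse[of rZero rOrder 0 n 1]
    by (simp add: round_map_def offsets_def)
  have "(round_map (-1) 0 n ^^ k) ((round_map 1 n 0 ^^ k) V) = V" for k
  proof (induction k)
    case (Suc k)
    \<comment> \<open>The last forward round meets the first backward round, and this pair in the
      middle cancels.\<close>
    have "(round_map (-1) 0 n ^^ Suc k) ((round_map 1 n 0 ^^ Suc k) V) =
        (round_map (-1) 0 n ^^ k) (round_map (-1) 0 n (round_map 1 n 0 ((round_map 1 n 0 ^^ k) V)))"
      by (simp only: funpow_Suc_right[of k "round_map (-1) 0 n"]
          funpow.simps(2)[where f = "round_map 1 n 0"] comp_apply)
    then show ?case by (simp only: inv Suc)
  qed simp
  then show ?thesis .
qed

abbreviation "round_regs \<equiv> insert rRound vertex_regs"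

lemma ach_rounds:
  assumes R: "fixed_regs R" and off: "offsets od os p q" and V: "holds V mem"
  shows "ach (Clear rRound ;; While_Less rRound rOrder
      (half_com od os sub ;; half_com os od sub ;; Incr rRound ;; Skip)) run_time (R, mem, out)
    (\<lambda>(R', mem', out'). out' = out \<and> holds ((round_map (sgn_of sub) p q ^^ n) V) mem' \<and>
      same_except round_regs R R')"
proof -
  let ?F = "round_map (sgn_of sub) p q"
  define Inv where "Inv = (\<lambda>k (R', mem', out'). out' = out \<and> holds ((?F ^^ k) V) mem' \<and>
    same_except round_regs R R' \<and> R' rRound = k)"
  have body: "ach (half_com od os sub ;; half_com os od sub ;; Incr rRound ;; Skip)
      (half_time + (half_time + (1 + 0))) S (Inv (Suc k))"
    if k: "k < n" and inv: "Inv k S" for k S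
  proof -
    obtain R0 mem0 where S: "S = (R0, mem0, out)" and V0: "holds ((?F ^^ k) V) mem0"
      and same0: "same_except round_regs R R0" and R0: "R0 rRound = k"
      using inv by (cases S) (auto simp: Inv_def)
    have fixed0: "fixed_regs R0" using fixed_regs_same[OF R same0] by simp
    show ?thesis
      unfolding S
    proof (rule ach_seq, rule ach_mono[OF ach_half[OF fixed0 off V0]])
      fix S1
      assume "case S1 of (R', mem', out') \<Rightarrow> out' = out \<and>
        holds (half_map (sgn_of sub) p q ((?F ^^ k) V)) mem' \<and> same_except vertex_regs R0 R'"
      then obtain R1 mem1 where S1: "S1 = (R1, mem1, out)"
        and V1: "holds (half_map (sgn_of sub) p q ((?F ^^ k) V)) mem1"
        and same1: "same_except vertex_regs R0 R1" by (cases S1) auto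
      have fixed1: "fixed_regs R1" using fixed_regs_same[OF fixed0 same1] by simp
      show "ach (half_com os od sub ;; Incr rRound ;; Skip) (half_time + (1 + 0)) S1 (Inv (Suc k))"
        unfolding S1
      proof (rule ach_seq, rule ach_mono[OF ach_half[OF fixed1 offsets_sym[OF off] V1]])
        fix S2
        assume "case S2 of (R', mem', out') \<Rightarrow> out' = out \<and>
          holds (half_map (sgn_of sub) q p (half_map (sgn_of sub) p q ((?F ^^ k) V))) mem' \<and>
          same_except vertex_regs R1 R'"
        then obtain R2 mem2 where S2: "S2 = (R2, mem2, out)"
          and V2: "holds ((?F ^^ Suc k) V) mem2" and same2: "same_except vertex_regs R1 R2"
          by (cases S2) (auto simp: round_map_def)
        have "same_except vertex_regs R0 R2" using same1 same2 by (rule same_except_trans) simp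
        then have "R2 rRound = k" "same_except round_regs R R2"
          using same_exceptD[of vertex_regs R0 R2 rRound] R0 same_except_trans[OF same0] by auto
        then show "ach (Incr rRound ;; Skip) (1 + 0) S2 (Inv (Suc k))"
          unfolding S2 using V2 k small_values
          by (intro ach_incr ach_skip) (simp_all add: Inv_def)
      qed (simp add: half_time_def)
    qed (simp add: half_time_def)
  qed
  have bound: "fst S rOrder = n" if "Inv v S" for v S
    using that fixed_regs_same[OF R, of round_regs "fst S"] by (auto simp: Inv_def fixed_regs_def)
  have "ach (While_Less rRound rOrder (half_com od os sub ;; half_com os od sub ;; Incr rRound ;; Skip))
      ((\<Sum>k<n. half_time + (half_time + (1 + 0)) + 2) + 1) (R(rRound := 0), mem, out) (Inv n)"
  proof (rule ach_while[of n Inv, OF _ body])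
    show "Inv 0 (R(rRound := 0), mem, out)" using V by (simp add: Inv_def)
  qed (use bound in \<open>auto simp: Inv_def\<close>)
  from ach_clear[OF this] show ?thesis
    by (rule ach_mono) (auto simp: run_time_def Inv_def algebra_simps)
qed

lemma ach_forward:
  assumes "fixed_regs R" "holds V mem"
  shows "ach forward_com run_time (R, mem, out) (\<lambda>(R', mem', out').
    out' = out \<and> holds (forward V) mem' \<and> same_except round_regs R R')"
  using ach_rounds[OF assms(1) _ assms(2), of rOrder rZero n 0 False out]
  by (simp add: forward_com_def offsets_def sgn_of_def)

lemma ach_backward:
  assumes "fixed_regs R" "holds V mem"
  shows "ach backward_com run_time (R, mem, out) (\<lambda>(R', mem', out').
    out' = out \<and> holds (backward V) mem' \<and> same_except round_regs R R')"
  using ach_rounds[OF assms(1) _ assms(2), of rZero rOrder 0 n True out]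
  by (simp add: backward_com_def offsets_def sgn_of_def)

text \<open>\<open>17 < a\<close> keeps the result register apart from the fixed values, the probe
  position and everything that a round touches, so the bit survives the undoing.\<close>

lemma ach_probe:
  assumes R: "fixed_regs R" "R rProbe = r + 2 * n * b" and rb: "r < 2 * n" "b < B"
    and V: "holds V mem" and a: "17 < a"
  shows "ach (probe_com a) (2 * run_time + 6) (R, mem, out) (\<lambda>(R', mem', out').
    out' = out \<and> holds (flip V) mem' \<and> same_except (insert a round_regs) R R' \<and>
    R' a = of_bool (bit (forward V r) b))" (is "ach _ _ _ ?Q")
proof -
  have "ach (probe_com a) (run_time + (1 + (1 + (run_time + (1 + (1 + (1 + (1 + 0)))))))) (R, mem, out) ?Q"
    unfolding probe_com_def
  proof (rule ach_seq, rule ach_mono[OF ach_forward[OF R(1) V]])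
    fix S1
    assume "case S1 of (R', mem', out') \<Rightarrow>
      out' = out \<and> holds (forward V) mem' \<and> same_except round_regs R R'"
    then obtain R1 mem1 where S1: "S1 = (R1, mem1, out)" and V1: "holds (forward V) mem1"
      and same1: "same_except round_regs R R1" by (cases S1) auto
    define R2 where "R2 = R1(rIndex := R1 rProbe, a := of_bool (bit (forward V r) b))"
    have probe: "R1 rProbe = r + 2 * n * b" using same_exceptD[OF same1] R(2) by simp
    have rd: "mem1 ! (r + 2 * n * b) = bit (forward V r) b" using holds_bits_nth[OF V1 rb] .
    have len: "length mem1 = limit" using V1 by (simp add: holds_bits_def)
    have same2: "same_except (insert a round_regs) R R2"
      using same1 by (auto simp: same_except_def R2_def)
    have fixed2: "fixed_regs R2" using fixed_regs_same[OF R(1) same2] a by simp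
    have rest: "ach (backward_com ;; Copy rIndex rSource ;; Ins (Read rX) ;; Incr rX ;; Ins (Write rX) ;; Skip)
        (run_time + (1 + (1 + (1 + (1 + 0))))) (R2, mem1, out) ?Q"
    proof (rule ach_seq, rule ach_mono[OF ach_backward[OF fixed2 V1]])
      fix S3
      assume "case S3 of (R', mem', out') \<Rightarrow>
        out' = out \<and> holds (backward (forward V)) mem' \<and> same_except round_regs R2 R'"
      then obtain R3 mem3 where S3: "S3 = (R3, mem3, out)" and V3: "holds V mem3"
        and same3: "same_except round_regs R2 R3" by (cases S3) (auto simp: backward_forward)
      have fixed3: "fixed_regs R3" using fixed_regs_same[OF fixed2 same3] by simp
      then have src: "R3 rSource = s" by (simp add: fixed_regs_def)
      have "same_except (insert a round_regs) R R3"
        using same2 same3 by (rule same_except_trans) auto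
      moreover have "R3 a = of_bool (bit (forward V r) b)"
        using same_exceptD[OF same3, of a] a by (simp add: R2_def)
      moreover have B_pos: "0 < B" using rb by simp
      have idx: "s < limit" using index_less[OF _ B_pos, of s] s_less by simp
      have "mem3 ! s = bit (V s) 0" using holds_bits_nth[OF V3 _ B_pos, of s] s_less by simp
      moreover have "holds (flip V) (mem3[s := \<not> bit (V s) 0])"
      proof -
        have "(\<lambda>r b. if r = s \<and> b = 0 then \<not> bit (V s) 0 else bit (V r) b) = (\<lambda>r. bit (flip V r))"
          by (auto simp: fun_eq_iff flip_def bit_flip_bit_iff)
        with holds_bits_update[OF V3 _ B_pos, of s "\<not> bit (V s) 0"] s_less show ?thesis by simp
      qed
      moreover have "length mem3 = limit" using V3 by (simp add: holds_bits_def)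
      ultimately show "ach (Copy rIndex rSource ;; Ins (Read rX) ;; Incr rX ;; Ins (Write rX) ;; Skip)
          (1 + (1 + (1 + (1 + 0)))) S3 ?Q"
        unfolding S3 using src idx a small_values n_pos
        by (intro straight_line) (simp_all add: bit_0)
    qed simp
    show "ach (Copy rIndex rProbe ;; Ins (Read a) ;; backward_com ;; Copy rIndex rSource ;; Ins (Read rX) ;;
        Incr rX ;; Ins (Write rX) ;; Skip) (1 + (1 + (run_time + (1 + (1 + (1 + (1 + 0))))))) S1 ?Q"
      unfolding S1
    proof (rule ach_copy, rule ach_read)
      have "R1(rIndex := R1 rProbe, a := of_bool (mem1 ! (R1(rIndex := R1 rProbe)) rIndex)) = R2"
        by (simp add: R2_def probe rd)
      then show "ach (backward_com ;; Copy rIndex rSource ;; Ins (Read rX) ;; Incr rX ;; Ins (Write rX) ;; Skip)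
        (run_time + (1 + (1 + (1 + (1 + 0)))))
        (R1(rIndex := R1 rProbe, a := of_bool (mem1 ! (R1(rIndex := R1 rProbe)) rIndex)), mem1, out) ?Q"
        using rest by (simp only:)
      show "(R1(rIndex := R1 rProbe)) rIndex < length mem1"
        using index_less[OF rb] len probe by simp
    qed
  qed simp
  then show ?thesis by (rule ach_time) simp
qed

section \<open>Comparing the two runs digit by digit\<close>

definition differs :: "(nat \<Rightarrow> int) \<Rightarrow> nat \<Rightarrow> bool" where
  "differs V j \<longleftrightarrow> bit (forward V (t + n * (j mod 2))) (j div 2) \<noteq>
     bit (forward (flip V) (t + n * (j mod 2))) (j div 2)"

lemma flip_flip [simp]: "flip (flip V) = V"
proof -
  have "flip_bit 0 (flip_bit 0 x) = x" for x :: int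
    by (rule bit_eqI) (auto simp: bit_flip_bit_iff)
  then show ?thesis by (simp add: flip_def fun_eq_iff)
qed

abbreviation "compare_regs \<equiv> {rFirst, rSecond, rFound, rProbe} \<union> round_regs"

lemma ach_compare:
  assumes R: "fixed_regs R" "R rProbe = t + n * j" "R rFound \<le> 2 * j" and j: "j < 2 * B"
    and V: "holds V mem"
  shows "ach compare_com (4 * run_time + 21) (R, mem, out) (\<lambda>(R', mem', out').
    out' = out \<and> holds V mem' \<and> same_except compare_regs R R' \<and> R' rProbe = t + n * Suc j \<and>
    R' rFound \<le> 2 * Suc j \<and> (0 < R' rFound \<longleftrightarrow> 0 < R rFound \<or> differs V j))" (is "ach _ _ _ ?Q")
proof -
  define r b where "r = t + n * (j mod 2)" and "b = j div 2"
  define x y where "x = bit (forward V r) b" and "y = bit (forward (flip V) r) b"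
  have d: "differs V j \<longleftrightarrow> x \<noteq> y" by (simp add: differs_def x_def y_def r_def b_def)
  have p: "t + n * j = r + 2 * n * b"
  proof -
    have "n * j = n * (2 * (j div 2) + j mod 2)" by simp
    also have "\<dots> = n * (j mod 2) + 2 * n * (j div 2)" by (simp only: distrib_left)
    finally show ?thesis by (simp add: r_def b_def)
  qed
  have b: "b < B" using j by (simp add: b_def less_mult_imp_div_less)
  have r: "r < 2 * n" using t_less by (cases "even j") (auto simp: r_def odd_iff_mod_2_eq_one)
  have "n * j \<le> limit" using j by simp
  then have room': "t + n * j + n < 2 ^ W" "2 * j + 2 < 2 ^ W"
  proof -
    have "j \<le> n * j" using n_pos by simp
    then show "2 * j + 2 < 2 ^ W" using \<open>n * j \<le> limit\<close> room by linarith
    show "t + n * j + n < 2 ^ W" using \<open>n * j \<le> limit\<close> room t_less n_le_limit by linarith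
  qed
  let ?rest = "Less_To rX rFirst rSecond ;; Plus rFound rX ;; Less_To rX rSecond rFirst ;;
    Plus rFound rX ;; Plus rProbe rOrder ;; Skip"
  let ?t = "3 + (1 + (3 + (1 + (1 + 0))))"
  have "ach compare_com ((2 * run_time + 6) + ((2 * run_time + 6) + ?t)) (R, mem, out) ?Q"
    unfolding compare_com_def
  proof (rule ach_seq, rule ach_mono[OF ach_probe[OF R(1) R(2)[unfolded p] r b V]])
    fix S1
    assume "case S1 of (R', mem', out') \<Rightarrow> out' = out \<and> holds (flip V) mem' \<and>
      same_except (insert rFirst round_regs) R R' \<and> R' rFirst = of_bool (bit (forward V r) b)"
    then obtain R1 mem1 where S1: "S1 = (R1, mem1, out)" and V1: "holds (flip V) mem1"
      and same1: "same_except (insert rFirst round_regs) R R1" and R1: "R1 rFirst = of_bool x"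
      by (cases S1) (auto simp: x_def)
    have fixed1: "fixed_regs R1" using fixed_regs_same[OF R(1) same1] by simp
    have probe1: "R1 rProbe = r + 2 * n * b" using same_exceptD[OF same1] R(2) p by simp
    show "ach (probe_com rSecond ;; ?rest) ((2 * run_time + 6) + ?t) S1 ?Q"
      unfolding S1
    proof (rule ach_seq, rule ach_mono[OF ach_probe[OF fixed1 probe1 r b V1]])
      fix S2
      assume "case S2 of (R', mem', out') \<Rightarrow> out' = out \<and> holds (flip (flip V)) mem' \<and>
        same_except (insert rSecond round_regs) R1 R' \<and> R' rSecond = of_bool (bit (forward (flip V) r) b)"
      then obtain R2 mem2 where S2: "S2 = (R2, mem2, out)" and V2: "holds V mem2"
        and same2: "same_except (insert rSecond round_regs) R1 R2" and R2: "R2 rSecond = of_bool y"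
        by (cases S2) (auto simp: y_def)
      have fixed2: "fixed_regs R2" using fixed_regs_same[OF fixed1 same2] by simp
      have first: "R2 rFirst = of_bool x" using same_exceptD[OF same2] R1 by simp
      have found: "R2 rFound = R rFound" "R2 rProbe = t + n * j"
        using same_exceptD[OF same2] same_exceptD[OF same1] R(2) by simp_all
      have ord: "R2 rOrder = n" using fixed2 by (simp add: fixed_regs_def)
      have same: "same_except compare_regs R R2"
        using same1 same2 by (rule same_except_trans) auto
      show "ach ?rest ?t S2 ?Q"
        unfolding S2 using room' R(3) same V2
        by (intro straight_line) (auto simp: first R2 found ord d)
    qed simp_all
  qed simp_all
  then show ?thesis by (rule ach_time) simp
qed


section \<open>Computing the tape length by additions\<close>

lemma ach_square:
  assumes R: "R rVertex = 0" "R rSquare = 0" "R rOrder = n" "R rStride = 2 * n"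
  shows "ach (While_Less rVertex rOrder (Plus rSquare rStride ;; Plus rSquare rStride ;; Incr rVertex ;; Skip))
    (5 * n + 1) (R, mem, out)
    (\<lambda>S. S = (R(rSquare := 4 * n * n, rVertex := n), mem, out))"
proof -
  define Inv where "Inv = (\<lambda>k S. S = (R(rSquare := 4 * n * k, rVertex := k), mem, out))"
  have body: "ach (Plus rSquare rStride ;; Plus rSquare rStride ;; Incr rVertex ;; Skip)
      (1 + (1 + (1 + 0))) S (Inv (Suc k))" if k: "k < n" and inv: "Inv k S" for k S
  proof -
    have "n * Suc k \<le> n * n" using k by (intro mult_le_mono2) simp
    moreover have "4 * (n * n) \<le> limit" using n_pos by (simp add: precision_def)
    moreover have "4 * n * k + 4 * n = 4 * (n * Suc k)" by simp
    ultimately have "4 * n * k + 4 * n < 2 ^ W" using room by linarith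
    then show ?thesis
      unfolding inv[unfolded Inv_def] using R k small_values
      by (intro ach_plus ach_incr ach_skip) (simp_all add: Inv_def fun_eq_iff)
  qed
  have "ach (While_Less rVertex rOrder (Plus rSquare rStride ;; Plus rSquare rStride ;; Incr rVertex ;; Skip))
      ((\<Sum>k<n. 1 + (1 + (1 + 0)) + 2) + 1) (R, mem, out) (Inv n)"
    by (rule ach_while[of n Inv, OF _ body]) (use R in \<open>auto simp: Inv_def fun_eq_iff\<close>)
  then show ?thesis by (rule ach_mono) (simp_all add: Inv_def)
qed

lemma floorlog_power: "2 ^ k \<le> n \<longleftrightarrow> k < floorlog 2 n" for k
  using floorlog_le_iff[of 2 n k] by (auto simp: not_le[symmetric] simp del: not_le)

text \<open>The power starts at 1 and is doubled while it is at most \<open>n\<close>, hence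
  \<open>floorlog 2 n\<close> times. Together with the initial value this makes
  \<open>floorlog 2 n + 1\<close> copies of \<open>4 * n * n\<close>.\<close>

lemma ach_limit:
  assumes R: "R rPower = 1" "R rSquare = 4 * n * n" "R rLimit = 4 * n * n" "R rSucc = Suc n"
  shows "ach (While_Less rPower rSucc (Plus rPower rPower ;; Plus rLimit rSquare ;; Skip))
    (4 * n + 1) (R, mem, out)
    (\<lambda>S. S = (R(rLimit := limit, rPower := 2 ^ floorlog 2 n), mem, out))"
proof -
  let ?L = "floorlog 2 n"
  define Inv where "Inv = (\<lambda>k S. S = (R(rLimit := 4 * n * n * Suc k, rPower := 2 ^ k), mem, out))"
  have "4 * n * n * (l + 1) = 2 * n * (2 * n * (l + 1))" for l
    by algebra
  then have limit_eq: "4 * n * n * (?L + 1) = limit" by (simp only: precision_def)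
  have body: "ach (Plus rPower rPower ;; Plus rLimit rSquare ;; Skip)
      (1 + (1 + 0)) S (Inv (Suc k))" if k: "k < ?L" and inv: "Inv k S" for k S
  proof -
    have "4 * n * n * Suc (Suc k) \<le> 4 * n * n * (?L + 1)" using k by (intro mult_le_mono2) simp
    also note limit_eq
    finally have "4 * n * n * Suc (Suc k) < 2 ^ W" using room by linarith
    moreover have "2 * 2 ^ k < (2::nat) ^ W" using k small_values floorlog_power[of k] by linarith
    ultimately show ?thesis
      unfolding inv[unfolded Inv_def] using R
      by (intro ach_plus ach_skip) (simp_all add: Inv_def fun_eq_iff)
  qed
  have "ach (While_Less rPower rSucc (Plus rPower rPower ;; Plus rLimit rSquare ;; Skip))
      ((\<Sum>k<?L. 1 + (1 + 0) + 2) + 1) (R, mem, out) (Inv ?L)"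
    by (rule ach_while[of ?L Inv, OF _ body])
      (use R floorlog_power in \<open>auto simp: Inv_def fun_eq_iff less_Suc_eq_le\<close>)
  then show ?thesis
  proof (rule ach_mono)
    have "?L \<le> n"
    proof (rule ccontr)
      assume "\<not> ?L \<le> n"
      then have "2 ^ n \<le> n" by (simp add: floorlog_power)
      then show False using less_exp[of n] by simp
    qed
    then show "(\<Sum>k<?L. 1 + (1 + 0) + 2) + 1 \<le> 4 * n + 1" by simp
    show "S = (R(rLimit := limit, rPower := 2 ^ ?L), mem, out)" if "Inv ?L S" for S
      using that by (simp only: Inv_def Suc_eq_plus1 limit_eq)
  qed
qed

lemma ach_setup:
  "ach setup_com (9 * n + 12) ((\<lambda>_. 0), mem, out)
    (\<lambda>(R', mem', out'). mem' = mem \<and> out' = out \<and> fixed_regs R' \<and> R' rFound = 0)" (is "ach _ _ _ ?Q")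
proof -
  let ?R0 = "(\<lambda>_. 0)(rOrder := n, rSource := s, rTarget := t, rStride := n, rStride := 2 * n,
    rOne := 1, rSucc := n, rSucc := Suc n)"
  let ?loop2 = "Copy rLimit rSquare ;; One rPower ;;
    While_Less rPower rSucc (Plus rPower rPower ;; Plus rLimit rSquare ;; Skip)"
  let ?R1 = "?R0(rSquare := 4 * n * n, rVertex := n)"
  have 2: "ach ?loop2 (1 + (1 + (4 * n + 1))) (?R1, mem, out) ?Q"
    by (rule ach_copy, rule ach_one, rule ach_mono[OF ach_limit])
      (auto simp: fixed_regs_def)
  have 1: "ach (While_Less rVertex rOrder (Plus rSquare rStride ;; Plus rSquare rStride ;; Incr rVertex ;; Skip) ;; ?loop2)
      (5 * n + 1 + (1 + (1 + (4 * n + 1)))) (R, mem, out) ?Q"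
    if "R = ?R0" for R
    unfolding that by (rule ach_seq, rule ach_mono[OF ach_square]) (use 2 in auto)
  have "ach setup_com (1 + (1 + (1 + (1 + (1 + (1 + (1 + (1 + (5 * n + 1 + (1 + (1 + (4 * n + 1))))))))))))
      ((\<lambda>_. 0), mem, out) ?Q"
    unfolding setup_com_def
    apply (rule ach_query[where v = n])
      apply (rule ach_query[where v = s])
        apply (rule ach_query[where v = t])
          apply (rule ach_copy ach_plus ach_one ach_incr)+
                apply (rule 1)
    using small_values s_less t_less by (auto simp: order source target fun_upd_def)
  then show ?thesis by (rule ach_time) simp
qed

definition total_time :: nat where
  "total_time = 9 * n + 12 + (1 + (2 * B * (4 * run_time + 23) + 1 + 3))"

lemma ach_main:
  assumes V: "holds V mem"
  shows "ach main_com total_time ((\<lambda>_. 0), mem, [])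
    (\<lambda>(R', mem', out'). mem' = mem \<and> out' = [\<exists>j<2 * B. differs V j])" (is "ach _ _ _ ?Q")
  unfolding main_com_def total_time_def
proof (rule ach_seq, rule ach_mono[OF ach_setup])
  let ?answer = "If_Less rZero rFound (Ins (Out True)) (Ins (Out False))"
  fix S :: store
  assume "case S of (R', mem', out') \<Rightarrow> mem' = mem \<and> out' = [] \<and> fixed_regs R' \<and> R' rFound = 0"
  then obtain R where S: "S = (R, mem, [])" and R: "fixed_regs R" "R rFound = 0" by (cases S) auto
  let ?R = "R(rProbe := R rTarget)"
  define Inv where "Inv = (\<lambda>j (R', mem', out'). out' = ([] :: bool list) \<and> holds V mem' \<and>
    same_except compare_regs ?R R' \<and> R' rProbe = t + n * j \<and> R' rFound \<le> 2 * j \<and>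
    (0 < R' rFound \<longleftrightarrow> (\<exists>i<j. differs V i)))"
  have fixed: "fixed_regs ?R" using R(1) by (simp add: fixed_regs_def)
  have body: "ach compare_com (4 * run_time + 21) S (Inv (Suc j))"
    if j: "j < 2 * B" and inv: "Inv j S" for j S
  proof -
    obtain R' mem' where S: "S = (R', mem', [])" and V': "holds V mem'"
      and same: "same_except compare_regs ?R R'"
      and R': "R' rProbe = t + n * j" "R' rFound \<le> 2 * j" "0 < R' rFound \<longleftrightarrow> (\<exists>i<j. differs V i)"
      using inv by (cases S) (auto simp: Inv_def)
    have "fixed_regs R'" using fixed_regs_same[OF fixed same] by simp
    from ach_compare[OF this R'(1,2) j V'] show ?thesis
      unfolding S
    proof (rule ach_mono)
      fix S'
      assume "case S' of (R'', mem'', out'') \<Rightarrow> out'' = ([] :: bool list) \<and> holds V mem'' \<and>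
        same_except compare_regs R' R'' \<and> R'' rProbe = t + n * Suc j \<and>
        R'' rFound \<le> 2 * Suc j \<and> (0 < R'' rFound \<longleftrightarrow> 0 < R' rFound \<or> differs V j)"
      then show "Inv (Suc j) S'"
        using same_except_trans[OF same, of compare_regs "fst S'" compare_regs] R'(3)
        by (cases S') (auto simp: Inv_def less_Suc_eq)
    qed simp
  qed
  have bound: "fst S rLimit = limit" if "Inv j S" for j S
    using that fixed_regs_same[OF fixed, of compare_regs "fst S"] by (auto simp: Inv_def fixed_regs_def)
  have loop: "ach (While_Less rProbe rLimit compare_com) ((\<Sum>j<2 * B. 4 * run_time + 21 + 2) + 1)
      (?R, mem, []) (Inv (2 * B))"
  proof (rule ach_while[of "2 * B" Inv, OF _ body])
    fix j S
    assume j: "j < 2 * B" and inv: "Inv j S"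
    \<comment> \<open>The limit is \<open>n * (2 * B)\<close> and \<open>t < n\<close>, so the
      address stays below it for exactly \<open>2 * B\<close> iterations.\<close>
    have "t + n * j < n * Suc j" using t_less by simp
    also have "\<dots> \<le> n * (2 * B)" using j by (intro mult_le_mono2) simp
    finally show "fst S rProbe < fst S rLimit" using inv bound[OF inv] by (auto simp: Inv_def)
  next
    fix S
    assume inv: "Inv (2 * B) S"
    then show "\<not> fst S rProbe < fst S rLimit" using bound[OF inv] by (auto simp: Inv_def)
  next
    show "Inv 0 (?R, mem, [])" using R V by (simp add: Inv_def fixed_regs_def)
  qed
  have answer: "ach ?answer (1 + 2) S ?Q" if inv: "Inv (2 * B) S" for S
  proof -
    obtain R' mem' where S: "S = (R', mem', [])" and V': "holds V mem'"
      and same: "same_except compare_regs ?R R'"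
      and R': "0 < R' rFound \<longleftrightarrow> (\<exists>i<2 * B. differs V i)"
      using inv by (cases S) (auto simp: Inv_def)
    have "mem' = mem" using V V' by (rule holds_bits_unique[rotated])
    moreover have "R' rZero = 0" using fixed_regs_same[OF fixed same] by (simp add: fixed_regs_def)
    ultimately show ?thesis
      unfolding S using R' by (intro ach_if ach_ins) (auto simp: bounded_def)
  qed
  have "ach (While_Less rProbe rLimit compare_com ;; ?answer)
      ((\<Sum>j<2 * B. 4 * run_time + 21 + 2) + 1 + (1 + 2)) (?R, mem, []) ?Q"
    by (rule ach_seq, rule ach_mono[OF loop order.refl answer])
  then have "ach (While_Less rProbe rLimit compare_com ;; ?answer)
      (2 * B * (4 * run_time + 23) + 1 + 3) (?R, mem, []) ?Q"
    by (rule ach_time) simp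
  then show "ach (Copy rProbe rTarget ;; While_Less rProbe rLimit compare_com ;; ?answer)
      (1 + (2 * B * (4 * run_time + 23) + 1 + 3)) S ?Q"
    unfolding S by (rule ach_copy)
qed simp

end

section \<open>Counting walks\<close>

lemma sum_list_combine:
  "(\<Sum>u\<leftarrow>xs. f u + a * g u) = (\<Sum>u\<leftarrow>xs. f u) + a * (\<Sum>u\<leftarrow>xs. g u :: int)"
  by (induction xs) (simp_all add: algebra_simps)

lemma member_le_sum_list_int:
  "u \<in> set xs \<Longrightarrow> (\<And>u. 0 \<le> f u) \<Longrightarrow> (f u :: int) \<le> (\<Sum>u\<leftarrow>xs. f u)"
proof (induction xs)
  case (Cons a xs)
  have "0 \<le> (\<Sum>u\<leftarrow>xs. f u)" by (rule sum_list_nonneg) (use Cons.prems in auto)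
  with Cons show ?case by (auto intro: add_increasing[OF Cons.prems(2)])
qed simp

lemma sum_list_le_length:
  "(\<And>u. f u \<le> c) \<Longrightarrow> (\<Sum>u\<leftarrow>xs. f u :: int) \<le> int (length xs) * c"
  by (induction xs) (auto simp: algebra_simps add_mono)

context path_counting
begin

lemma half_map_combine:
  "half_map c p q (\<lambda>r. V r + a * U r) = (\<lambda>r. half_map c p q V r + a * half_map c p q U r)"
  by (auto simp: half_map_def sum_list_combine algebra_simps)

text \<open>Linearity separates the perturbation from the unknown contents: \<open>V\<close> is
  whatever the tape holds, and the response to \<open>U\<close> does not depend on it.\<close>

lemma rounds_combine:
  "(round_map c p q ^^ k) (\<lambda>r. V r + a * U r) =
     (\<lambda>r. (round_map c p q ^^ k) V r + a * (round_map c p q ^^ k) U r)"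
proof (induction k)
  case (Suc k)
  then show ?case by (simp add: round_map_def half_map_combine)
qed simp

text \<open>The response of the rounds to a unit at register \<open>s\<close>. An entry counts walks
  from \<open>s\<close> to its vertex, each together with a choice of the half rounds in which its
  arcs are taken.\<close>

definition walks :: "nat \<Rightarrow> nat \<Rightarrow> int" where
  "walks k = (round_map 1 n 0 ^^ k) (\<lambda>r. of_bool (r = s))"

lemma walks_Suc: "walks (Suc k) = half_map 1 0 n (half_map 1 n 0 (walks k))"
  by (simp add: walks_def round_map_def)

text \<open>A half round adds to each entry and keeps its old value, so a walk that has arrived
  keeps contributing in all later rounds.\<close>

lemma half_map_mono:
  assumes "\<And>r. 0 \<le> V r"
  shows "V r \<le> half_map 1 p q V r"
  using sum_list_nonneg[of "map (\<lambda>u. V (u + q)) (in_nbrs I (r - p))"] assms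
  by (auto simp: half_map_def)

lemma half_map_nonneg: "(\<And>r. 0 \<le> V r) \<Longrightarrow> 0 \<le> half_map 1 p q V r"
  using half_map_mono[of V r p q] by (meson order_trans)

lemma walks_nonneg: "0 \<le> walks k r"
proof (induction k arbitrary: r)
  case (Suc k)
  then show ?case unfolding walks_Suc by (intro half_map_nonneg)
qed (simp add: walks_def)

lemma walks_mono: "j \<le> k \<Longrightarrow> walks j r \<le> walks k r"
proof (induction k rule: dec_induct)
  case (step k)
  have "walks k r \<le> half_map 1 n 0 (walks k) r" by (rule half_map_mono) (rule walks_nonneg)
  also have "\<dots> \<le> walks (Suc k) r"
    unfolding walks_Suc by (rule half_map_mono) (intro half_map_nonneg walks_nonneg)
  finally show ?case using step by simp
qed simp

text \<open>The factor \<open>n + 1\<close> stands for the entry itself and at most \<open>n\<close>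
  in-neighbors.\<close>

lemma half_map_le:
  assumes "\<And>r. 0 \<le> V r" "\<And>r. V r \<le> c"
  shows "half_map 1 p q V r \<le> c * (int n + 1)"
proof -
  have c: "0 \<le> c" using assms order_trans by blast
  show ?thesis
  proof (cases "p \<le> r \<and> r < p + n")
    case True
    then have "r - p < n" by linarith
    then have "int (length (in_nbrs I (r - p))) * c \<le> int n * c"
      using c in_degree_le by (intro mult_right_mono) auto
    moreover have "(\<Sum>u\<leftarrow>in_nbrs I (r - p). V (u + q)) \<le> int (length (in_nbrs I (r - p))) * c"
      by (rule sum_list_le_length) (rule assms(2))
    ultimately have "V r + (\<Sum>u\<leftarrow>in_nbrs I (r - p). V (u + q)) \<le> c + int n * c"
      using assms(2)[of r] by linarith
    then show ?thesis using True by (simp add: half_map_def algebra_simps)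
  next
    case False
    have "0 \<le> c * int n" using c by simp
    then show ?thesis using False assms(2)[of r] by (auto simp: half_map_def algebra_simps)
  qed
qed

lemma walks_le: "walks k r \<le> (int n + 1) ^ (2 * k)"
proof (induction k arbitrary: r)
  case (Suc k)
  have "walks (Suc k) r \<le> (int n + 1) ^ (2 * k) * (int n + 1) * (int n + 1)"
    unfolding walks_Suc
    by (intro half_map_le half_map_nonneg walks_nonneg Suc)
  then show ?case by (simp add: algebra_simps)
qed (simp add: walks_def)

lemma walks_less: "walks n r < 2 ^ B"
proof -
  let ?L = "floorlog 2 n"
  have "n < 2 ^ ?L" using floorlog_bounds[of n 2] n_pos by simp
  then have "int n < 2 ^ ?L" by (metis of_nat_less_iff of_nat_numeral of_nat_power)
  then have "int n + 1 \<le> 2 ^ ?L" by linarith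
  then have "(int n + 1) ^ (2 * n) \<le> (2 ^ ?L) ^ (2 * n)" by (intro power_mono) auto
  also have "\<dots> = 2 ^ (?L * (2 * n))" by (simp only: power_mult)
  \<comment> \<open>\<open>B\<close> exceeds the exponent by \<open>2 * n\<close>, which is
    positive.\<close>
  also have "\<dots> < 2 ^ B" using n_pos by (intro power_strict_increasing) (auto simp: precision_def)
  finally show ?thesis using walks_le[of n r] by linarith
qed

section \<open>Walk counts and reachability\<close>

definition arc_rel :: "(nat \<times> nat) set" where
  "arc_rel = {(u, v). v < n \<and> u \<in> set (in_nbrs I v)}"

text \<open>The invariant behind the absence of false positives. The residue modulo \<open>n\<close>
  names the vertex of a register in either family.\<close>

definition supported :: "(nat \<Rightarrow> int) \<Rightarrow> bool" where
  "supported V \<longleftrightarrow> (\<forall>r. V r \<noteq> 0 \<longrightarrow> r < 2 * n \<and> (s, r mod n) \<in> arc_rel\<^sup>*)"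

lemma supported_half_map:
  assumes "supported V" "p \<in> {0, n}" "q \<in> {0, n}"
  shows "supported (half_map 1 p q V)"
  unfolding supported_def
proof (intro allI impI)
  fix r
  assume nz: "half_map 1 p q V r \<noteq> 0"
  show "r < 2 * n \<and> (s, r mod n) \<in> arc_rel\<^sup>*"
  proof (cases "V r = 0")
    case False
    then show ?thesis using assms(1) by (simp add: supported_def)
  next
    case True
    with nz have range: "p \<le> r" "r < p + n" and "(\<Sum>u\<leftarrow>in_nbrs I (r - p). V (u + q)) \<noteq> 0"
      by (auto simp: half_map_def split: if_splits)
    then obtain u where u: "u \<in> set (in_nbrs I (r - p))" "V (u + q) \<noteq> 0"
      by (metis (mono_tags, lifting) map_eq_conv sum_list_0)
    have "r - p < n" using range by linarith
    moreover have r: "r mod n = r - p"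
      using range assms(2) by (auto simp: le_mod_geq)
    moreover have "u < n" using in_nbrs_less u(1) \<open>r - p < n\<close> by blast
    then have "(u + q) mod n = u" using assms(3) by auto
    then have "(s, u) \<in> arc_rel\<^sup>*" using u(2) assms(1) unfolding supported_def by metis
    ultimately have "(s, r mod n) \<in> arc_rel\<^sup>*"
      using u(1) by (auto simp: arc_rel_def intro: rtrancl_into_rtrancl)
    then show ?thesis using range assms(2) by auto
  qed
qed

lemma supported_walks: "supported (walks k)"
proof (induction k)
  case 0
  then show ?case using s_less by (simp add: walks_def supported_def)
next
  case (Suc k)
  then show ?case unfolding walks_Suc by (intro supported_half_map) auto
qed

text \<open>A full round carries a positive entry across any arc: from \<open>x u\<close> it reaches
  \<open>y v\<close> in the first half and survives the second, from \<open>y u\<close> it survives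
  the first half and reaches \<open>x v\<close> in the second. One round per arc is therefore
  enough, whichever family the walk is in.\<close>

lemma walks_step:
  assumes "0 < walks k u \<or> 0 < walks k (u + n)" "(u, v) \<in> arc_rel"
  shows "0 < walks (Suc k) v \<or> 0 < walks (Suc k) (v + n)"
proof -
  have v: "v < n" "u \<in> set (in_nbrs I v)" and u: "u < n"
    using assms(2) in_nbrs_less by (auto simp: arc_rel_def)
  define V where "V = half_map 1 n 0 (walks k)"
  have nonneg: "0 \<le> V r" for r unfolding V_def by (intro half_map_nonneg walks_nonneg)
  from assms(1) show ?thesis
  proof
    assume "0 < walks k u"
    also have "\<dots> \<le> (\<Sum>u\<leftarrow>in_nbrs I v. walks k (u + 0))"
      using member_le_sum_list_int[OF v(2), of "\<lambda>u. walks k (u + 0)"] walks_nonneg by simp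
    also have "\<dots> \<le> V (v + n)" using v walks_nonneg by (simp add: V_def half_map_def)
    also have "\<dots> \<le> walks (Suc k) (v + n)"
      unfolding walks_Suc V_def[symmetric] by (rule half_map_mono) (rule nonneg)
    finally show ?thesis by simp
  next
    assume "0 < walks k (u + n)"
    also have "\<dots> \<le> V (u + n)" unfolding V_def by (rule half_map_mono) (rule walks_nonneg)
    also have "\<dots> \<le> (\<Sum>u\<leftarrow>in_nbrs I v. V (u + n))"
      using member_le_sum_list_int[OF v(2), of "\<lambda>u. V (u + n)"] nonneg by simp
    also have "\<dots> \<le> walks (Suc k) v"
      unfolding walks_Suc V_def[symmetric] using v nonneg by (simp add: half_map_def)
    finally show ?thesis by simp
  qed
qed

lemma walks_pos:
  "(s, v) \<in> arc_rel ^^ k \<Longrightarrow> 0 < walks k v \<or> 0 < walks k (v + n)"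
proof (induction k arbitrary: v)
  case (Suc k)
  then obtain u where "(s, u) \<in> arc_rel ^^ k" "(u, v) \<in> arc_rel" by auto
  with Suc.IH walks_step show ?case by blast
qed (simp add: walks_def)

text \<open>If all low digits agree, \<open>2 ^ b\<close> divides the difference, which is
  \<open>y\<close> up to sign; below \<open>2 ^ b\<close> that leaves only 0.\<close>

lemma low_bits_differ:
  fixes x y :: int
  assumes "0 \<le> y" "y < 2 ^ b" "\<bar>a\<bar> = 1"
  shows "(\<exists>j<b. bit x j \<noteq> bit (x + a * y) j) \<longleftrightarrow> y \<noteq> 0"
proof
  assume y: "y \<noteq> 0"
  show "\<exists>j<b. bit x j \<noteq> bit (x + a * y) j"
  proof (rule ccontr)
    assume "\<not> (\<exists>j<b. bit x j \<noteq> bit (x + a * y) j)"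
    then have "take_bit b (x + a * y) = take_bit b x"
      by (intro bit_eqI) (auto simp: bit_take_bit_iff)
    then have "2 ^ b dvd (x + a * y) - x" by (simp add: take_bit_eq_mod mod_eq_dvd_iff)
    then have "2 ^ b dvd y" using assms(3) by (auto simp: abs_if split: if_splits)
    then show False using zdvd_imp_le[of "2 ^ b" y] y assms by simp
  qed
qed auto

lemma forward_flip:
  "\<exists>a. \<bar>a\<bar> = 1 \<and> forward (flip V) = (\<lambda>r. forward V r + a * walks n r)"
proof -
  define a :: int where "a = (if even (V s) then 1 else - 1)"
  have "flip_bit 0 x = x + (if even x then 1 else - 1)" for x :: int
    by (cases "even x") (auto simp: flip_bit_0 elim!: evenE oddE)
  then have "flip V = (\<lambda>r. V r + a * of_bool (r = s))"
    by (auto simp: flip_def a_def fun_eq_iff)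
  then show ?thesis
    using rounds_combine[of n 1 n 0 V a "\<lambda>r. of_bool (r = s)"]
    by (intro exI[of _ a]) (simp add: walks_def a_def)
qed

lemma differs_iff:
  "(\<exists>j<2 * B. differs V j) \<longleftrightarrow> walks n t \<noteq> 0 \<or> walks n (t + n) \<noteq> 0"
proof -
  obtain a where a: "\<bar>a\<bar> = 1" "forward (flip V) = (\<lambda>r. forward V r + a * walks n r)"
    using forward_flip by blast
  have iff: "(\<exists>b<B. bit (forward V r) b \<noteq> bit (forward (flip V) r) b) \<longleftrightarrow> walks n r \<noteq> 0" for r
    using low_bits_differ[OF walks_nonneg walks_less a(1)] unfolding a(2) .
  have "(\<exists>j<2 * B. differs V j) \<longleftrightarrow>
      (\<exists>i<2. \<exists>b<B. bit (forward V (t + n * i)) b \<noteq> bit (forward (flip V) (t + n * i)) b)"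
  proof
    assume "\<exists>j<2 * B. differs V j"
    then obtain j where "j < 2 * B" "differs V j" by blast
    then show "\<exists>i<2. \<exists>b<B. bit (forward V (t + n * i)) b \<noteq> bit (forward (flip V) (t + n * i)) b"
      by (intro exI[of _ "j mod 2"] conjI exI[of _ "j div 2"])
        (auto simp: differs_def less_mult_imp_div_less)
  next
    assume "\<exists>i<2. \<exists>b<B. bit (forward V (t + n * i)) b \<noteq> bit (forward (flip V) (t + n * i)) b"
    then obtain i b where "i < 2" "b < B"
      "bit (forward V (t + n * i)) b \<noteq> bit (forward (flip V) (t + n * i)) b" by blast
    then show "\<exists>j<2 * B. differs V j"
      \<comment> \<open>Inverts the splitting of \<open>j\<close> into family \<open>j mod 2\<close>
        and digit \<open>j div 2\<close>.\<close>
      by (intro exI[of _ "2 * b + i"]) (auto simp: differs_def)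
  qed
  also have "\<dots> \<longleftrightarrow> (\<exists>i<2. walks n (t + n * i) \<noteq> 0)" by (simp only: iff)
  also have "\<dots> \<longleftrightarrow> walks n t \<noteq> 0 \<or> walks n (t + n) \<noteq> 0"
    by (simp add: numeral_2_eq_2 less_Suc_eq conj_disj_distribR ex_disj_distrib)
  finally show ?thesis .
qed

text \<open>Every content of the catalytic tape is the binary notation of some integers, so the
  analysis applies to an arbitrary initial tape.\<close>

lemma ex_holds:
  assumes "length mem = limit"
  shows "\<exists>V. holds V mem"
proof
  show "holds (\<lambda>r. horner_sum of_bool 2 (map (\<lambda>b. mem ! (r + 2 * n * b)) [0..<B])) mem"
    using assms by (auto simp: holds_bits_def bit_horner_sum_bit_iff)
qed

end

section \<open>The running time and the main theorem\<close>

context path_counting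
begin

text \<open>The precision is at most \<open>6 * q\<close>. One half round then costs at most
  \<open>113 * (M * q)\<close>, all rounds in one direction \<open>231 * (x * (M * q))\<close>, and
  \<open>2 * B\<close> comparisons with four such runs each \<open>11364 * z\<close>. The constants
  absorb the lower-order terms, which works because \<open>x\<close>, \<open>M\<close> and
  \<open>l\<close> are at least 1.\<close>

lemma total_time_le:
  assumes "num_arcs \<le> m" "1 \<le> m"
    and l: "1 \<le> l" "real (floorlog 2 n) + 1 \<le> 3 * l"
  shows "real total_time \<le> 11390 * (real n ^ 3 * real m * l ^ 2)"
proof -
  define x where "x = real n"
  define M where "M = real m"
  define q where "q = x * l"
  define z where "z = x * M * q * q"
  have x: "1 \<le> x" and M: "1 \<le> M" using n_pos assms(2) by (simp_all add: x_def M_def)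
  have xq: "x \<le> q" using x l(1) by (simp add: q_def)
  then have q: "1 \<le> q" using x by linarith
  have qM: "q \<le> M * q" using M q by simp
  have Mq: "M \<le> M * q" using M q by simp
  have "real B = 2 * x * (real (floorlog 2 n) + 1)" by (simp add: precision_def x_def algebra_simps)
  also have "\<dots> \<le> 2 * x * (3 * l)" using l(2) x by (intro mult_left_mono) auto
  finally have B: "real B \<le> 6 * q" by (simp add: q_def)
  have "real half_time = real num_arcs * (16 * real B + 9) + 6 * x + 2"
    by (simp add: half_time_def x_def)
  also have "real num_arcs * (16 * real B + 9) \<le> M * (105 * q)"
    using assms(1) B q by (intro mult_mono) (auto simp: M_def)
  finally have h: "real half_time \<le> 113 * (M * q)" using xq qM q by linarith
  have "2 * real half_time + 3 \<le> 229 * (M * q)" using h qM q by linarith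
  then have "x * (2 * real half_time + 3) \<le> x * (229 * (M * q))"
    using x by (intro mult_left_mono) auto
  then have "real run_time \<le> 229 * (x * (M * q)) + 2" by (simp add: run_time_def x_def)
  moreover have xMq: "M * q \<le> x * (M * q)" using x M q by simp
  ultimately have r: "real run_time \<le> 231 * (x * (M * q))" using qM q by linarith
  have z1: "x * (M * q) \<le> z"
  proof -
    have "x * (M * q) * 1 \<le> x * (M * q) * q" using q x M by (intro mult_left_mono) auto
    then show ?thesis by (simp add: z_def mult.assoc)
  qed
  have "4 * real run_time + 23 \<le> 947 * (x * (M * q))" using r xMq qM q by linarith
  then have "2 * real B * (4 * real run_time + 23) \<le> (2 * (6 * q)) * (947 * (x * (M * q)))"
    using B q by (intro mult_mono) auto
  also have "\<dots> = 11364 * z" by (simp add: z_def algebra_simps)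
  finally have "2 * real B * (4 * real run_time + 23) \<le> 11364 * z" .
  moreover have "real total_time = 9 * x + 17 + 2 * real B * (4 * real run_time + 23)"
    by (simp add: total_time_def x_def algebra_simps)
  ultimately have "real total_time \<le> 11390 * z" using xq qM q xMq z1 by linarith
  also have "z = real n ^ 3 * real m * l ^ 2"
    by (simp add: z_def q_def x_def M_def power3_eq_cube power2_eq_square algebra_simps)
  finally show ?thesis .
qed

end

section \<open>The machine and its resource bounds\<close>

definition path_machine :: machine where
  "path_machine = instr_machine 26 (code main_com 0)"

lemma wf_path_machine: "wf_machine path_machine"
  unfolding path_machine_def
proof (rule wf_instr_machine)
  show "\<forall>i\<in>set (code main_com 0). instr_wf 26 (length (code main_com 0)) i"
    using instr_wf_code[OF main_com_wf, of 0] by simp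
qed simp

lemma (in path_counting) path_machine_decides:
  assumes mem: "length \<tau> = limit"
    and time: "real (total_time * (2 * W + 2)) \<le> T" and space: "real W < S"
    and b: "b \<longleftrightarrow> walks n t \<noteq> 0 \<or> walks n (t + n) \<noteq> 0"
  shows "catalytic_decides path_machine I \<tau> S T b"
proof -
  obtain V where V: "holds V \<tau>" using ex_holds[OF mem] by blast
  have "code_at (code main_com 0) 0 (code main_com 0)"
    unfolding code_at_def by (intro exI[of _ "[]"]) simp
  moreover have "represents W 0 ((\<lambda>_. 0), \<tau>, []) (init_config path_machine \<tau>)"
    unfolding represents_def
    by (auto simp: bounded_def conf_at_def init_config_def tapes_hold_def track_def path_machine_def
        instr_machine_def)
  ultimately have "leads path_machine I W (total_time * (2 * W + 2)) (init_config path_machine \<tau>)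
      (\<lambda>d. \<exists>S'. (case S' of (R', mem', out') \<Rightarrow> mem' = \<tau> \<and> out' = [\<exists>j<2 * B. differs V j]) \<and>
        represents W (0 + code_length main_com) S' d)"
    unfolding path_machine_def by (intro achD[OF ach_main[OF V]])
  then obtain k d S' where k: "k \<le> total_time * (2 * W + 2)"
    and run: "run path_machine I (init_config path_machine \<tau>) k = Some d"
    and S': "case S' of (R', mem', out') \<Rightarrow> mem' = \<tau> \<and> out' = [\<exists>j<2 * B. differs V j]"
      "represents W (code_length main_com) S' d"
    and pos: "\<forall>j\<le>k. \<forall>e x. run path_machine I (init_config path_machine \<tau>) j = Some e \<longrightarrow> pos e x \<le> W"
    unfolding leads_def by auto
  have "state d = halt_state path_machine" "out_bits d = [b]" "cat d = \<tau>"
    using S' differs_iff[of V] b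
    by (auto simp: represents_def conf_at_def path_machine_def instr_machine_def)
  moreover have "real k \<le> T" using k time by (meson of_nat_le_iff order_trans)
  moreover have "\<forall>j\<le>k. \<forall>e x. run path_machine I (init_config path_machine \<tau>) j = Some e \<longrightarrow>
      real (pos e x) < S"
    using pos space by (meson of_nat_le_iff order_le_less_trans)
  ultimately show ?thesis
    using run unfolding catalytic_decides_def by (intro exI[of _ k] exI[of _ d]) blast
qed

text \<open>With \<open>p = 2 ^ floorlog 2 n\<close> the left side is at most
  \<open>16 * p ^ 3 + 4\<close>, because \<open>n\<close> and \<open>floorlog 2 n + 1\<close> are
  both at most \<open>p\<close>. The cube explains the factor 3, and \<open>2 ^ 5\<close> covers the
  constants.\<close>

lemma floorlog_room:
  assumes "1 \<le> n"
  shows "4 * (2 * n * precision n) + 4 < 2 ^ (3 * floorlog 2 n + 5)"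
proof -
  let ?p = "2 ^ floorlog 2 n :: nat"
  have n: "n \<le> ?p" using floorlog_bounds[of n 2] assms by simp
  have "floorlog 2 n + 1 \<le> ?p" using less_exp[of "floorlog 2 n"] by (simp only: Suc_eq_plus1[symmetric] Suc_le_eq)
  then have "n * n * (floorlog 2 n + 1) \<le> ?p * ?p * ?p" using n by (intro mult_mono) auto
  moreover have "4 * (2 * n * precision n) = 16 * (n * n * (floorlog 2 n + 1))"
    by (simp only: precision_def)
  moreover have "1 \<le> ?p * ?p * ?p" by simp
  moreover have "2 ^ (3 * floorlog 2 n + 5) = 32 * (?p * ?p * ?p)"
    by (simp add: power_add power_mult power3_eq_cube power_mult[of _ _ 3] mult.commute[of 3])
  ultimately show ?thesis by linarith
qed

lemma floorlog_le_log:
  assumes "1 \<le> n"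
  shows "real (floorlog 2 n) \<le> log 2 (real n + 1) + 1" "1 \<le> log 2 (real n + 1)"
proof -
  have "2 ^ (floorlog 2 n - 1) \<le> n" "0 < floorlog 2 n"
    using floorlog_bounds[of n 2] assms by (auto simp: floorlog_def)
  then have "real (2 ^ (floorlog 2 n - 1)) \<le> real n" by (simp only: of_nat_le_iff)
  then have "2 ^ (floorlog 2 n - 1) \<le> real n + 1" unfolding of_nat_power of_nat_numeral by linarith
  then have "real (floorlog 2 n - 1) \<le> log 2 (real n + 1)"
    by (simp add: le_log_iff powr_realpow)
  then show "real (floorlog 2 n) \<le> log 2 (real n + 1) + 1" by simp
  show "1 \<le> log 2 (real n + 1)" using assms by (simp add: le_log_iff)
qed

section \<open>Connecting the counts with the graph\<close>

lemma oracle_path_counting: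
  fixes G :: "nat pair_pre_digraph"
  assumes "pair_digraph G" "pverts G = {..<n}" "s \<in> pverts G" "t \<in> pverts G" "oracle_for G s t I"
  shows "path_counting I (3 * floorlog 2 n + 5) n s t"
proof -
  interpret pair_digraph G by fact
  have n: "order_of I = n" using assms(2,5) unfolding oracle_for_def by (metis lessThan_eq_iff)
  have nbrs: "distinct (in_nbrs I v)" "set (in_nbrs I v) = {u. (u, v) \<in> parcs G}" if "v < n" for v
    using assms(5) that n by (auto simp: oracle_for_def)
  have sub: "set (in_nbrs I v) \<subseteq> {..<n}" if "v < n" for v
    using nbrs[OF that] in_arcsD1 assms(2) by auto
  show ?thesis
  proof
    show "order_of I = n" by (fact n)
    show "source_of I = s" "target_of I = t" using assms(5) by (simp_all add: oracle_for_def)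
    show "s < n" "t < n" using assms by auto
    then show "4 * (2 * n * precision n) + 4 < 2 ^ (3 * floorlog 2 n + 5)"
      by (intro floorlog_room) simp
    fix v
    assume v: "v < n"
    show "u < n" if "u \<in> set (in_nbrs I v)" for u using sub[OF v] that by auto
    show "length (in_nbrs I v) \<le> n"
      using card_mono[OF _ sub[OF v]] distinct_card[OF nbrs(1)[OF v]] by simp
  qed simp
qed

text \<open>Arcs are counted by their heads; the disjoint union of the in-neighborhoods is the
  converse of the arc set.\<close>

lemma sum_in_degrees:
  fixes G :: "nat pair_pre_digraph"
  assumes "pair_digraph G" "pverts G = {..<n}" "oracle_for G s t I"
  shows "(\<Sum>v<n. length (in_nbrs I v)) = card (parcs G)"
proof -
  interpret pair_digraph G by fact
  have n: "order_of I = n" using assms(2,3) unfolding oracle_for_def by (metis lessThan_eq_iff)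
  have "length (in_nbrs I v) = card {u. (u, v) \<in> parcs G}" if "v < n" for v
    using assms(3) that n distinct_card[of "in_nbrs I v"] by (auto simp: oracle_for_def)
  then have "(\<Sum>v<n. length (in_nbrs I v)) = (\<Sum>v<n. card {u. (u, v) \<in> parcs G})" by simp
  also have "\<dots> = card (SIGMA v:{..<n}. {u. (u, v) \<in> parcs G})"
    using in_arcsD1 assms(2) by (intro card_SigmaI[symmetric]) (auto intro: finite_subset[of _ "{..<n}"])
  also have "(SIGMA v:{..<n}. {u. (u, v) \<in> parcs G}) = (parcs G)\<inverse>"
    using in_arcsD2 assms(2) by auto
  finally show ?thesis by (simp add: card_inverse)
qed

text \<open>Nonzero counts sit only at reachable vertices, and reachability gives a path without
  repeated vertices. Conversely such a path has at most \<open>n\<close> arcs, so one round per arc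
  makes a count positive and the remaining rounds do not decrease it.\<close>

lemma walks_iff_apath:
  fixes G :: "nat pair_pre_digraph"
  assumes "pair_digraph G" "pverts G = {..<n}" "s \<in> pverts G" "t \<in> pverts G" "oracle_for G s t I"
    and "path_counting I W n s t"
  shows "path_counting.walks I n s n t \<noteq> 0 \<or> path_counting.walks I n s n (t + n) \<noteq> 0 \<longleftrightarrow>
    (\<exists>p. pre_digraph.apath (with_proj G) s p t)"
proof -
  interpret pair_digraph G by fact
  interpret P: path_counting I W n s t by fact
  have nbrs: "set (in_nbrs I v) = {u. (u, v) \<in> parcs G}" if "v < n" for v
    using assms(5) that unfolding oracle_for_def P.order by blast
  have "v < n" if "(u, v) \<in> parcs G" for u v using in_arcsD2[OF that] assms(2) by simp
  then have rel: "P.arc_rel = parcs G" by (auto simp: P.arc_rel_def nbrs)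
  have t: "t < n" by (rule P.t_less)
  show ?thesis
  proof
    assume "P.walks n t \<noteq> 0 \<or> P.walks n (t + n) \<noteq> 0"
    then have "(s, t) \<in> (parcs G)\<^sup>*"
      using P.supported_walks[of n, unfolded P.supported_def rel, rule_format, of t]
        P.supported_walks[of n, unfolded P.supported_def rel, rule_format, of "t + n"] t
      by auto
    then have "s \<rightarrow>\<^sup>*\<^bsub>with_proj G\<^esub> t"
    proof induction
      case base
      then show ?case using assms(3) by simp
    next
      case (step u v)
      then show ?case by (meson reachable_adj_trans)
    qed
    then show "\<exists>p. apath s p t" by (simp add: reachable_apath)
  next
    assume "\<exists>p. apath s p t"
    then obtain p where p: "apath s p t" by blast
    have "(u, v) \<in> parcs G ^^ length p" if "awalk u p v" for u v p
      using that
    proof (induction p arbitrary: u)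
      case (Cons a p)
      then have "(u, snd a) \<in> parcs G" "(snd a, v) \<in> parcs G ^^ length p"
        by (auto simp: awalk_Cons_iff)
      then show ?case by (simp only: list.size(4) add_Suc_right add_0_right relpow_Suc_I2)
    qed (simp add: awalk_Nil_iff)
    then have "0 < P.walks (length p) t \<or> 0 < P.walks (length p) (t + n)"
      using p P.walks_pos by (simp add: rel apath_def)
    moreover have "length p \<le> n" using length_apath[OF p] assms(2) by simp
    ultimately show "P.walks n t \<noteq> 0 \<or> P.walks n (t + n) \<noteq> 0"
      using P.walks_mono[of "length p" n t] P.walks_mono[of "length p" n "t + n"] by linarith
  qed
qed

theorem theorem1p1:
  shows "\<exists>(M :: machine) (cat_len :: nat \<Rightarrow> nat) (C :: real) (k :: nat).
    wf_machine M \<and>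
    (\<forall>n\<ge>1. real (cat_len n) \<le> C * real n ^ 2 * log 2 (real n + 1) ^ k) \<and>
    (\<forall>(G :: nat pair_pre_digraph) (n :: nat) (m :: nat) (s :: nat) (t :: nat) (I :: graph_oracle)
       (\<tau> :: bool list).
       pair_digraph G \<and> pverts G = {..<n} \<and> card (parcs G) = m \<and>
       s \<in> pverts G \<and> t \<in> pverts G \<and> oracle_for G s t I \<and> length \<tau> = cat_len n \<longrightarrow>
       catalytic_decides M I \<tau>
         (C * log 2 (real n + 1))
         (C * real n ^ 3 * real (max 1 m) * log 2 (real n + 1) ^ k)
         (\<exists>p. pre_digraph.apath (with_proj G) s p t))"
proof (intro exI conjI allI impI)
  \<comment> \<open>The running time dictates the constant, 11390 * 24 = 273360 rounded up. Of the
    exponent 3, two logarithms come from the square of the precision and one from the length of a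
    sweep.\<close>
  let ?C = "300000 :: real"
  show "wf_machine path_machine" by (rule wf_path_machine)
  fix n :: nat
  assume n: "1 \<le> n"
  let ?l = "log 2 (real n + 1)"
  note l = floorlog_le_log[OF n]
  have l3: "real (floorlog 2 n) + 1 \<le> 3 * ?l" using l by linarith
  have "real (2 * n * precision n) = 4 * real n ^ 2 * (real (floorlog 2 n) + 1)"
    by (simp add: precision_def power2_eq_square algebra_simps)
  also have "\<dots> \<le> 4 * real n ^ 2 * (3 * ?l)" using l3 by (intro mult_left_mono) auto
  \<comment> \<open>Space has a single logarithm; it is raised to the exponent shared with the time
    bound, as \<open>?l\<close> is at least 1.\<close>
  also have "\<dots> \<le> 4 * real n ^ 2 * (3 * ?l ^ 3)"
    using self_le_power[OF l(2), of 3] by (intro mult_left_mono) auto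
  also have "\<dots> \<le> ?C * real n ^ 2 * ?l ^ 3" using l by simp
  finally show "real (2 * n * precision n) \<le> ?C * real n ^ 2 * ?l ^ 3" .
next
  let ?C = "300000 :: real"
  fix G :: "nat pair_pre_digraph" and n m s t :: nat and I :: graph_oracle and \<tau> :: "bool list"
  assume asm: "pair_digraph G \<and> pverts G = {..<n} \<and> card (parcs G) = m \<and>
    s \<in> pverts G \<and> t \<in> pverts G \<and> oracle_for G s t I \<and> length \<tau> = 2 * n * precision n"
  interpret pair_digraph G using asm by simp
  let ?W = "3 * floorlog 2 n + 5" and ?l = "log 2 (real n + 1)"
  interpret P: path_counting I ?W n s t using asm by (intro oracle_path_counting) auto
  have n: "1 \<le> n" using P.n_pos by simp
  note l = floorlog_le_log[OF n]
  have l3: "real (floorlog 2 n) + 1 \<le> 3 * ?l" using l by linarith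
  have "P.num_arcs = m" using sum_in_degrees[of G n s t I] asm by (simp add: P.num_arcs_def)
  then have "real P.total_time \<le> 11390 * (real n ^ 3 * real (max 1 m) * ?l ^ 2)"
    using l(2) l3 by (intro P.total_time_le) auto
  moreover have W: "2 * real ?W + 2 \<le> 24 * ?l" "real ?W < ?C * ?l"
  proof -
    \<comment> \<open>With \<open>x \<le> y + 1\<close> the first left side is at most
      \<open>6 * y + 18\<close>, and 18 is at most \<open>18 * y\<close>.\<close>
    have "2 * (3 * x + 5) + 2 \<le> 24 * y" "3 * x + 5 < ?C * y" if "x \<le> y + 1" "1 \<le> y" for x y :: real
      using that by simp_all
    from this[OF l] show "2 * real ?W + 2 \<le> 24 * ?l" "real ?W < ?C * ?l" by simp_all
  qed
  ultimately have "real P.total_time * (2 * real ?W + 2) \<le>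
      11390 * (real n ^ 3 * real (max 1 m) * ?l ^ 2) * (24 * ?l)"
    using W(1) by (intro mult_mono) auto
  also have "\<dots> = 273360 * (real n ^ 3 * real (max 1 m) * ?l ^ 3)"
    by (simp add: power3_eq_cube power2_eq_square)
  also have "\<dots> \<le> ?C * (real n ^ 3 * real (max 1 m) * ?l ^ 3)"
    using l by (intro mult_right_mono) auto
  finally have time: "real (P.total_time * (2 * ?W + 2)) \<le> ?C * real n ^ 3 * real (max 1 m) * ?l ^ 3"
    by (simp add: mult.assoc)
  show "catalytic_decides path_machine I \<tau> (?C * ?l) (?C * real n ^ 3 * real (max 1 m) * ?l ^ 3)
      (\<exists>p. apath s p t)"
  proof (rule P.path_machine_decides)
    show "(\<exists>p. apath s p t) \<longleftrightarrow> P.walks n t \<noteq> 0 \<or> P.walks n (t + n) \<noteq> 0"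
      by (rule walks_iff_apath[symmetric]) (use asm P.path_counting_axioms in blast)+
    show "length \<tau> = 2 * n * precision n" using asm by blast
  qed (fact time W)+
qed

end
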